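(* Let $F$ be a finite family of convex sets in $\mathbb{R}^d$ and let $\mu : 2^F \to \mathbb{N}_0$ be the rank function of a loopless matroid on $F$. Suppose that for some integer $k$ with $0 \leq k < d$ there is a function $\varphi : F \to \mathbb{R}^k$ such that $$\operatorname{conv} G_1 \cap \operatorname{conv} G_2 = \emptyset \implies \operatorname{conv} \varphi(G_1) \cap \operatorname{conv} \varphi(G_2) = \emptyset$$ for all subfamilies $G_1, G_2 \subset F$ satisfying $\mu(G_1 \cup G_2) = |G_1| + |G_2|$. Then there exists a subfamily $G \subset F$ with $\mu(F \setminus G) \leq k+1$ which has a hyperplane transversal.
   Context: For a set $X$ of points in a Euclidean space, $\operatorname{conv} X$ denotes its convex hull. For a family $G$ of subsets of $\mathbb{R}^d$, $\operatorname{conv} G$ denotes the convex hull of the union of the members of $G$. For $G \subset F$, $\varphi(G) = \{\varphi(C) : C \in G\} \subset \mathbb{R}^k$, so $\operatorname{conv}\varphi(G)$ is the convex hull of this finite point set. A family may contain the same set repeatedly; repeated copies are regarded as distinct members of the family (and distinct elements of the matroid). A hyperplane transversal of a family $G$ of sets in $\mathbb{R}^d$ is an affine hyperplane in $\mathbb{R}^d$ that intersects every member of $G$; the empty family vacuously has a hyperplane transversal. Matroids are specified by their rank function; loopless means $\mu(\{C\}) = 1$ for every $C \in F$. *)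

theory Defs
  imports "HOL-Analysis.Analysis"
begin

(* A family of sets, possibly with repetitions, is a map K on a finite index set F.
   Its members are the indices, so a subfamily is a subset of F, cardinalities count
   repeated sets separately, and a matroid on the family is a matroid on F. *)

definition matroid_rank :: "'i set \<Rightarrow> ('i set \<Rightarrow> nat) \<Rightarrow> bool" where
  "matroid_rank F \<mu> \<longleftrightarrow>
     finite F \<and>
     (\<forall>X. X \<subseteq> F \<longrightarrow> \<mu> X \<le> card X) \<and>
     (\<forall>X Y. X \<subseteq> Y \<and> Y \<subseteq> F \<longrightarrow> \<mu> X \<le> \<mu> Y) \<and>
     (\<forall>X Y. X \<subseteq> F \<and> Y \<subseteq> F \<longrightarrow> \<mu> (X \<union> Y) + \<mu> (X \<inter> Y) \<le> \<mu> X + \<mu> Y)"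

definition loopless :: "'i set \<Rightarrow> ('i set \<Rightarrow> nat) \<Rightarrow> bool" where
  "loopless F \<mu> \<longleftrightarrow> (\<forall>i\<in>F. \<mu> {i} = 1)"

definition conv_family :: "('i \<Rightarrow> 'a::real_vector set) \<Rightarrow> 'i set \<Rightarrow> 'a set" where
  "conv_family K G = convex hull (\<Union>i\<in>G. K i)"

definition hyperplane :: "'a::euclidean_space set \<Rightarrow> bool" where
  "hyperplane H \<longleftrightarrow> (\<exists>a b. a \<noteq> 0 \<and> H = {x. a \<bullet> x = b})"

definition has_hyperplane_transversal :: "('i \<Rightarrow> 'a::euclidean_space set) \<Rightarrow> 'i set \<Rightarrow> bool" where
  "has_hyperplane_transversal K G \<longleftrightarrow> (\<exists>H. hyperplane H \<and> (\<forall>i\<in>G. H \<inter> K i \<noteq> {}))"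

(* Every type of class euclidean_space has positive dimension, so the k-dimensional space
   R^k, with k = 0 allowed, has to be given as a k-dimensional linear subspace V of some
   Euclidean space; convex hulls of subsets of V are the same in V and in the ambient space. *)

definition real_space_of_dim :: "nat \<Rightarrow> 'b::euclidean_space set \<Rightarrow> bool" where
  "real_space_of_dim k V \<longleftrightarrow> subspace V \<and> dim V = k"

end

theory Submission
  imports Defs "HOL-Library.Z2"
begin

text \<open>Suppose that every hyperplane \<open>u \<bullet> x = b\<close> misses members of total rank at least \<open>k + 2\<close>. For
  \<open>(u, b)\<close> in a \<open>(k + 1)\<close>-sphere record the missed members with the sign of the side on which they lie.
  Signed sets with independent support form complexes that are highly connected, so this gives an
  antipodal chain map from the sphere to the complex of all independent signed sets that some
  hyperplane separates. Sending a member \<open>i\<close> of sign \<open>\<plusminus>\<close> to \<open>\<plusminus>(\<phi> i, 1)\<close> maps that complex to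
  \<open>\<real>\<^sup>k\<^sup>+\<^sup>1\<close> antipodally, and the hypothesis says that it avoids the origin. This contradicts the
  Borsuk-Ulam theorem, whose mod 2 proof (counting crossings of a flag of half-spaces by the images
  of the standard hemispheres) is carried out directly on these chains.\<close>

subsection \<open>Mod 2 sums over the cells of a cubical sphere\<close>

text \<open>Dimensions: a hyperplane is a point \<open>(u, b)\<close> of a space of dimension d + 1,
  so a sphere of dimension k + 1 fits because k < d. The lift to \<open>(\<phi> i, 1)\<close> turns
  convex combinations into nonnegative ones, at the price of target dimension k + 1. Rank k + 2 is
  what permits filling cycles up to dimension k + 1. Two obstacles shape the proof. Members need be
  neither closed nor bounded, so the set missed by a hyperplane is not stable under small moves.
  Hence each member is traded for finitely many of its points, chosen so that disjoint hulls of the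
  finite sets still force disjoint hulls of the members. Compactness then gives a uniform margin,
  and a fine grid on which a member recorded at a face keeps its side on the whole cell. As sides
  are constant on cells, chains record unsigned independent sets and the signs are a function of the
  cell; equivariance becomes equality of the chains of antipodal cells. The second obstacle is
  degenerate position of the vectors: crossings are counted after a perturbation, which is harmless
  because positive independence is an open condition.\<close>

declare add_bit_eq_xor [simp del] mult_bit_eq_and [simp del]

lemma bit_cancel [simp]: "(x::bit) + x = 0" "(x::bit) + (x + y) = y"
  by (cases x; cases y; simp add: add_bit_eq_xor)+

lemma bit_add_eq_0: "(x::bit) + y = 0 \<longleftrightarrow> x = y"
  by (cases x; cases y; simp add: add_bit_eq_xor)

text \<open>Cells of the cubical grid: an even entry \<open>a\<close> stands for the point \<open>a\<close>, an odd entry for the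
  interval \<open>[a - 1, a + 1]\<close> in that coordinate. Antipodality is then negation of all entries.\<close>

type_synonym cube = "int list"

text \<open>The coboundary of a mod 2 cochain; the recursion is the product rule for the boundary of
  a product of cells.\<close>

fun bd :: "(cube \<Rightarrow> bit) \<Rightarrow> cube \<Rightarrow> bit" where
  "bd \<beta> [] = 0"
| "bd \<beta> (a # Q) = (if odd a then \<beta> ((a - 1) # Q) + \<beta> ((a + 1) # Q) else 0) + bd (\<lambda>R. \<beta> (a # R)) Q"

definition odd_sum :: "nat \<Rightarrow> (int \<Rightarrow> bit) \<Rightarrow> bit" where
  "odd_sum N g = (\<Sum>t<N. g (2 * int t + 1))"

text \<open>\<open>full_sum\<close>, \<open>sphere_sum\<close> and \<open>hemi_sum\<close> integrate
  a cochain over the top cells of the m-cube of side 4N, of its boundary sphere, and of the half of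
  the boundary of the (m+1)-cube with first coordinate at least 0. The recursions split off one
  coordinate, so that symmetry and Stokes become inductions on the dimension.\<close>

fun full_sum :: "nat \<Rightarrow> nat \<Rightarrow> (cube \<Rightarrow> bit) \<Rightarrow> bit" where
  "full_sum N 0 \<beta> = \<beta> []"
| "full_sum N (Suc m) \<beta> =
     odd_sum N (\<lambda>a. full_sum N m (\<lambda>Q. \<beta> (a # Q)) + full_sum N m (\<lambda>Q. \<beta> (- a # Q)))"

fun sphere_sum :: "nat \<Rightarrow> nat \<Rightarrow> (cube \<Rightarrow> bit) \<Rightarrow> bit" where
  "sphere_sum N 0 \<beta> = 0"
| "sphere_sum N (Suc m) \<beta> =
     full_sum N m (\<lambda>Q. \<beta> (2 * int N # Q)) + full_sum N m (\<lambda>Q. \<beta> (- 2 * int N # Q)) +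
     odd_sum N (\<lambda>a. sphere_sum N m (\<lambda>Q. \<beta> (a # Q)) + sphere_sum N m (\<lambda>Q. \<beta> (- a # Q)))"

definition hemi_sum :: "nat \<Rightarrow> nat \<Rightarrow> (cube \<Rightarrow> bit) \<Rightarrow> bit" where
  "hemi_sum N m \<beta> = full_sum N m (\<lambda>Q. \<beta> (2 * int N # Q)) +
     odd_sum N (\<lambda>a. sphere_sum N m (\<lambda>Q. \<beta> (a # Q)))"

lemma odd_sum_add: "odd_sum N (\<lambda>a. f a + g a) = odd_sum N f + odd_sum N g"
  by (simp add: odd_sum_def sum.distrib)

lemma odd_sum_cong:
  assumes "\<And>a. odd a \<Longrightarrow> 0 < a \<Longrightarrow> a < 2 * int N \<Longrightarrow> f a = g a"
  shows "odd_sum N f = odd_sum N g"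
  unfolding odd_sum_def by (rule sum.cong) (auto intro!: assms)

lemma odd_sum_telescope: "odd_sum N (\<lambda>a. g (a - 1) + g (a + 1)) = g 0 + g (2 * int N)"
  unfolding odd_sum_def
  by (induction N) (simp_all add: algebra_simps)

lemma bd_add: "bd (\<lambda>R. f R + g R) Q = bd f Q + bd g Q"
  by (induction Q arbitrary: f g) (auto simp: algebra_simps)

lemma bd_const [simp]: "bd (\<lambda>R. c) Q = 0"
  by (induction Q) auto

text \<open>Every face of codimension 2 lies in exactly two facets.\<close>

lemma bd_bd [simp]: "bd (bd \<beta>) Q = 0"
proof (induction Q arbitrary: \<beta>)
  case (Cons a Q)
  show ?case
    by (cases "odd a") (simp_all add: bd_add Cons algebra_simps)
qed simp

lemma full_sum_add: "full_sum N m (\<lambda>Q. f Q + g Q) = full_sum N m f + full_sum N m g"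
  by (induction m arbitrary: f g) (simp_all add: odd_sum_add algebra_simps)

lemma full_sum_cong:
  assumes "\<And>Q. length Q = m \<Longrightarrow> (\<forall>a\<in>set Q. odd a \<and> \<bar>a\<bar> < 2 * int N) \<Longrightarrow> f Q = g Q"
  shows "full_sum N m f = full_sum N m g"
  using assms
proof (induction m arbitrary: f g)
  case (Suc m)
  show ?case
    unfolding full_sum.simps
    by (intro odd_sum_cong arg_cong2[where f = "(+)"] Suc.IH Suc.prems) auto
qed simp

lemma full_sum_uminus: "full_sum N m (\<lambda>Q. \<beta> (map uminus Q)) = full_sum N m \<beta>"
proof (induction m arbitrary: \<beta>)
  case (Suc m)
  have "full_sum N m (\<lambda>Q. \<beta> (a # map uminus Q)) = full_sum N m (\<lambda>Q. \<beta> (a # Q))" for a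
    using Suc.IH[of "\<lambda>Q. \<beta> (a # Q)"] by simp
  then show ?case by (simp add: add.commute)
qed simp

lemma sphere_sum_add: "sphere_sum N m (\<lambda>Q. f Q + g Q) = sphere_sum N m f + sphere_sum N m g"
  by (induction m arbitrary: f g) (simp_all add: odd_sum_add full_sum_add algebra_simps)

lemma sphere_sum_cong:
  assumes "\<And>Q. length Q = m \<Longrightarrow> (\<forall>a\<in>set Q. \<bar>a\<bar> \<le> 2 * int N) \<Longrightarrow> \<exists>a\<in>set Q. \<bar>a\<bar> = 2 * int N \<Longrightarrow>
     length (filter odd Q) = m - 1 \<Longrightarrow> f Q = g Q"
  shows "sphere_sum N m f = sphere_sum N m g"
  using assms
proof (induction m arbitrary: f g)
  case (Suc m)
  have *: "full_sum N m (\<lambda>Q. f (c # Q)) = full_sum N m (\<lambda>Q. g (c # Q))" if "\<bar>c\<bar> = 2 * int N" for c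
  proof -
    have even_c: "even c" using that by presburger
    show ?thesis
      by (rule full_sum_cong, rule Suc.prems)
        (use that even_c in \<open>auto simp: less_imp_le filter_id_conv\<close>)
  qed
  have **: "sphere_sum N m (\<lambda>Q. f (c # Q)) = sphere_sum N m (\<lambda>Q. g (c # Q))"
    if "odd c" "\<bar>c\<bar> < 2 * int N" for c
  proof (cases m)
    case (Suc m')
    show ?thesis
      by (rule Suc.IH, rule Suc.prems) (use that Suc in auto)
  qed simp
  show ?case
    unfolding sphere_sum.simps
    by (intro odd_sum_cong arg_cong2[where f = "(+)"] * **) auto
qed simp

lemma sphere_sum_uminus: "sphere_sum N m (\<lambda>Q. \<beta> (map uminus Q)) = sphere_sum N m \<beta>"
proof (induction m arbitrary: \<beta>)
  case (Suc m)
  have "full_sum N m (\<lambda>Q. \<beta> (a # map uminus Q)) = full_sum N m (\<lambda>Q. \<beta> (a # Q))" for a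
    using full_sum_uminus[of N m "\<lambda>Q. \<beta> (a # Q)"] by simp
  moreover have "sphere_sum N m (\<lambda>Q. \<beta> (a # map uminus Q)) = sphere_sum N m (\<lambda>Q. \<beta> (a # Q))" for a
    using Suc.IH[of "\<lambda>Q. \<beta> (a # Q)"] by simp
  ultimately show ?case by (simp add: add.commute)
qed simp

text \<open>Stokes for the cube. In each coordinate the interior walls cancel in pairs, and so do
  the two copies of the wall at 0 that come from splitting the sum by sign; only the outer walls
  remain.\<close>

lemma full_sum_bd: "full_sum N m (bd \<beta>) = sphere_sum N m \<beta>"
proof (induction m arbitrary: \<beta>)
  case (Suc m)
  let ?h = "\<lambda>c. full_sum N m (\<lambda>Q. \<beta> (c # Q))"
  have eq: "full_sum N m (\<lambda>Q. bd \<beta> (c # Q)) =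
      ?h (c - 1) + ?h (c + 1) + sphere_sum N m (\<lambda>Q. \<beta> (c # Q))" if "odd c" for c
    using that by (simp add: full_sum_add Suc)
  have "full_sum N (Suc m) (bd \<beta>) =
     odd_sum N (\<lambda>a. (?h (a - 1) + ?h (a + 1)) + (?h (- (a - 1)) + ?h (- (a + 1)))
       + (sphere_sum N m (\<lambda>Q. \<beta> (a # Q)) + sphere_sum N m (\<lambda>Q. \<beta> (- a # Q))))"
    unfolding full_sum.simps
  proof (rule odd_sum_cong)
    fix a :: int assume "odd a"
    then have "odd (- a)" by simp
    note eqs = eq[OF \<open>odd a\<close>] eq[OF this]
    show "full_sum N m (\<lambda>Q. bd \<beta> (a # Q)) + full_sum N m (\<lambda>Q. bd \<beta> (- a # Q)) =
      (?h (a - 1) + ?h (a + 1)) + (?h (- (a - 1)) + ?h (- (a + 1)))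
       + (sphere_sum N m (\<lambda>Q. \<beta> (a # Q)) + sphere_sum N m (\<lambda>Q. \<beta> (- a # Q)))"
      unfolding eqs minus_diff_eq minus_add_distrib by (simp only: ac_simps diff_conv_add_uminus)
  qed
  also have "\<dots> = (?h 0 + ?h (2 * int N)) + (?h (- 0) + ?h (- (2 * int N))) +
      odd_sum N (\<lambda>a. (sphere_sum N m (\<lambda>Q. \<beta> (a # Q)) + sphere_sum N m (\<lambda>Q. \<beta> (- a # Q))))"
    by (subst odd_sum_add, subst odd_sum_add, subst odd_sum_telescope[of N ?h],
        subst odd_sum_telescope[of N "\<lambda>c. ?h (- c)"], rule refl)
  finally show ?case by (simp add: algebra_simps)
qed simp

text \<open>Stokes applied to \<open>bd \<beta>\<close>, whose own coboundary vanishes: the sphere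
  is closed.\<close>

lemma sphere_sum_bd [simp]: "sphere_sum N m (bd \<beta>) = 0"
proof -
  have "full_sum N m (\<lambda>Q. 0) = 0"
    by (induction m) (simp_all add: odd_sum_def)
  then show ?thesis
    using full_sum_bd[of N m "bd \<beta>"] by (simp add: bd_bd[abs_def])
qed

text \<open>Stokes for the hemisphere: its boundary is the equator, the sphere one dimension
  lower.\<close>

lemma hemi_sum_bd: "hemi_sum N m (bd \<beta>) = sphere_sum N m (\<lambda>Q. \<beta> (0 # Q))"
proof -
  let ?h = "\<lambda>c. sphere_sum N m (\<lambda>Q. \<beta> (c # Q))"
  have eq: "sphere_sum N m (\<lambda>Q. bd \<beta> (c # Q)) = ?h (c - 1) + ?h (c + 1)" if "odd c" for c
    using that by (simp add: sphere_sum_add)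
  have "odd_sum N (\<lambda>c. sphere_sum N m (\<lambda>Q. bd \<beta> (c # Q))) = odd_sum N (\<lambda>c. ?h (c - 1) + ?h (c + 1))"
    by (rule odd_sum_cong) (rule eq)
  also have "\<dots> = ?h 0 + ?h (2 * int N)" by (rule odd_sum_telescope)
  finally show ?thesis
    by (simp add: hemi_sum_def full_sum_bd algebra_simps)
qed

lemma hemi_sum_antipodal:
  "hemi_sum N m (\<lambda>Q. \<beta> Q + \<beta> (map uminus Q)) = sphere_sum N (Suc m) \<beta>"
proof -
  have "full_sum N m (\<lambda>Q. \<beta> (a # map uminus Q)) = full_sum N m (\<lambda>Q. \<beta> (a # Q))" for a
    using full_sum_uminus[of N m "\<lambda>Q. \<beta> (a # Q)"] by simp
  moreover have "sphere_sum N m (\<lambda>Q. \<beta> (a # map uminus Q)) = sphere_sum N m (\<lambda>Q. \<beta> (a # Q))" for a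
    using sphere_sum_uminus[of N m "\<lambda>Q. \<beta> (a # Q)"] by simp
  ultimately show ?thesis
    by (simp add: hemi_sum_def full_sum_add sphere_sum_add odd_sum_add algebra_simps)
qed

lemma hemi_sum_add: "hemi_sum N m (\<lambda>Q. f Q + g Q) = hemi_sum N m f + hemi_sum N m g"
  by (simp add: hemi_sum_def odd_sum_add full_sum_add sphere_sum_add algebra_simps)

lemma hemi_sum_cong:
  assumes "\<And>Q. length Q = Suc m \<Longrightarrow> (\<forall>a\<in>set Q. \<bar>a\<bar> \<le> 2 * int N) \<Longrightarrow> \<exists>a\<in>set Q. \<bar>a\<bar> = 2 * int N \<Longrightarrow>
     length (filter odd Q) = m \<Longrightarrow> f Q = g Q"
  shows "hemi_sum N m f = hemi_sum N m g"
proof -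
  have *: "full_sum N m (\<lambda>Q. f (2 * int N # Q)) = full_sum N m (\<lambda>Q. g (2 * int N # Q))"
    by (rule full_sum_cong, rule assms) (auto simp: less_imp_le)
  have **: "sphere_sum N m (\<lambda>Q. f (c # Q)) = sphere_sum N m (\<lambda>Q. g (c # Q))"
    if "odd c" "0 < c" "c < 2 * int N" for c
  proof (cases m)
    case (Suc m')
    show ?thesis
      by (rule sphere_sum_cong, rule assms) (use that Suc in auto)
  qed simp
  show ?thesis
    unfolding hemi_sum_def
    by (intro odd_sum_cong arg_cong2[where f = "(+)"] * **)
qed

section \<open>Antipodal cochains on the cubical sphere\<close>

definition cells :: "nat \<Rightarrow> nat \<Rightarrow> nat \<Rightarrow> cube set" where
  "cells N n j = {Q. length Q = Suc n \<and> (\<forall>a\<in>set Q. \<bar>a\<bar> \<le> 2 * int N) \<and> (\<exists>a\<in>set Q. \<bar>a\<bar> = 2 * int N) \<and>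
     length (filter odd Q) = j}"

text \<open>Cells with \<open>n - m\<close> leading zeros form a great m-sphere, and
  \<open>s m\<close> sums \<open>\<beta> Q + \<beta> (map uminus Q)\<close> over its upper
  hemisphere. By \<open>step\<close> and Stokes this is the sum of \<open>\<beta>\<close> over the
  great sphere one dimension lower, which splits into a hemisphere and its antipode. So
  \<open>s\<close> is constant, but \<open>vertex\<close> makes it start at 1 and \<open>top\<close>
  makes it end at 0.\<close>

lemma cubical_tucker:
  assumes vertex: "\<And>Q. Q \<in> cells N n 0 \<Longrightarrow> \<beta> Q + \<beta> (map uminus Q) = 1"
    and step: "\<And>j Q. \<lbrakk>Q \<in> cells N n (Suc j); Suc j \<le> n\<rbrakk> \<Longrightarrow> bd \<beta> Q = \<beta> Q + \<beta> (map uminus Q)"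
    and top: "\<And>Q. Q \<in> cells N n n \<Longrightarrow> \<beta> Q + \<beta> (map uminus Q) = 0"
  shows False
proof -
  define \<gamma> where "\<gamma> m Q = \<beta> (replicate (n - m) 0 @ Q)" for m Q
  define s where "s m = hemi_sum N m (\<lambda>Q. \<gamma> m Q + \<gamma> m (map uminus Q))" for m
  have pad: "replicate (n - m) 0 @ Q \<in> cells N n m"
    if "m \<le> n" "length Q = Suc m" "\<forall>a\<in>set Q. \<bar>a\<bar> \<le> 2 * int N" "\<exists>a\<in>set Q. \<bar>a\<bar> = 2 * int N"
      "length (filter odd Q) = m" for m Q
    using that by (auto simp: cells_def)
  have bd_pad: "bd \<beta>' (replicate l 0 @ Q) = bd (\<lambda>R. \<beta>' (replicate l 0 @ R)) Q" for \<beta>' l Q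
    by (induction l arbitrary: \<beta>') auto
  have uminus_pad: "\<gamma> m (map uminus Q) = \<beta> (map uminus (replicate (n - m) 0 @ Q))" for m Q
    by (simp add: \<gamma>_def map_replicate)
  have "s m = 1" if "m \<le> n" for m
    using that
  proof (induction m)
    case 0
    have "s 0 = sphere_sum N (Suc 0) (\<gamma> 0)"
      unfolding s_def by (rule hemi_sum_antipodal)
    also have "\<dots> = \<gamma> 0 [2 * int N] + \<gamma> 0 (map uminus [2 * int N])"
      by (simp add: odd_sum_def)
    also have "\<dots> = 1"
      unfolding uminus_pad unfolding \<gamma>_def by (rule vertex, rule pad) auto
    finally show ?case .
  next
    case (Suc m)
    have "s (Suc m) = hemi_sum N (Suc m) (bd (\<gamma> (Suc m)))"
      unfolding s_def
    proof (rule hemi_sum_cong)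
      fix Q :: cube
      assume "length Q = Suc (Suc m)" "\<forall>a\<in>set Q. \<bar>a\<bar> \<le> 2 * int N" "\<exists>a\<in>set Q. \<bar>a\<bar> = 2 * int N"
        "length (filter odd Q) = Suc m"
      from step[OF pad[OF Suc.prems this] Suc.prems]
      show "\<gamma> (Suc m) Q + \<gamma> (Suc m) (map uminus Q) = bd (\<gamma> (Suc m)) Q"
        unfolding uminus_pad unfolding \<gamma>_def by (simp add: bd_pad)
    qed
    also have "\<dots> = sphere_sum N (Suc m) (\<lambda>Q. \<gamma> (Suc m) (0 # Q))"
      by (rule hemi_sum_bd)
    also have "(\<lambda>Q. \<gamma> (Suc m) (0 # Q)) = \<gamma> m"
    proof
      fix Q
      have "n - m = Suc (n - Suc m)" using Suc.prems by simp
      then show "\<gamma> (Suc m) (0 # Q) = \<gamma> m Q"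
        by (simp add: \<gamma>_def replicate_app_Cons_same)
    qed
    also have "sphere_sum N (Suc m) (\<gamma> m) = s m"
      unfolding s_def by (rule hemi_sum_antipodal[symmetric])
    finally show ?case using Suc by simp
  qed
  then have "s n = 1" by simp
  moreover have "s n = hemi_sum N n (\<lambda>Q. 0)"
    unfolding s_def
    by (rule hemi_sum_cong, unfold uminus_pad, unfold \<gamma>_def, rule top, rule pad) auto
  moreover have "hemi_sum N n (\<lambda>Q. 0) = 0"
    using hemi_sum_add[of N n "\<lambda>Q. 0" "\<lambda>Q. 0"] by simp
  ultimately show False by simp
qed

subsection \<open>Filling cycles in matroid independence complexes\<close>

lemma matroid_rankD:
  assumes "matroid_rank F \<mu>"
  shows "finite F" "X \<subseteq> F \<Longrightarrow> \<mu> X \<le> card X" "X \<subseteq> Y \<Longrightarrow> Y \<subseteq> F \<Longrightarrow> \<mu> X \<le> \<mu> Y"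
    "X \<subseteq> F \<Longrightarrow> Y \<subseteq> F \<Longrightarrow> \<mu> (X \<union> Y) + \<mu> (X \<inter> Y) \<le> \<mu> X + \<mu> Y"
  using assms unfolding matroid_rank_def by blast+

lemma independent_subset:
  assumes "matroid_rank F \<mu>" "I \<subseteq> F" "\<mu> I = card I" "J \<subseteq> I"
  shows "\<mu> J = card J"
proof -
  note M = matroid_rankD[OF assms(1)]
  have fin: "finite I" using M(1) assms(2) finite_subset by blast
  have "\<mu> (J \<union> (I - J)) + \<mu> (J \<inter> (I - J)) \<le> \<mu> J + \<mu> (I - J)"
    by (rule M(4)) (use assms in auto)
  moreover have "J \<union> (I - J) = I" using assms by auto
  moreover have "\<mu> (I - J) \<le> card (I - J)" by (rule M(2)) (use assms in auto)
  moreover have "card (I - J) = card I - card J" "card J \<le> card I"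
    using assms fin by (auto simp: card_Diff_subset finite_subset card_mono)
  moreover have "\<mu> J \<le> card J" by (rule M(2)) (use assms in auto)
  ultimately show ?thesis using assms(3) by simp
qed

text \<open>A chain is its coefficient function. The empty set counts as a simplex, so this is the
  augmented complex, and it is graded below by the number of vertices.\<close>

definition simplicial_bd :: "'i set \<Rightarrow> ('i set \<Rightarrow> bit) \<Rightarrow> 'i set \<Rightarrow> bit" where
  "simplicial_bd A z J = (\<Sum>x\<in>A - J. z (insert x J))"

lemma simplicial_bd_insert:
  assumes "finite A" "e \<notin> A"
  shows "simplicial_bd (insert e A) z J =
    (if e \<in> J then simplicial_bd A z J else z (insert e J) + simplicial_bd A z J)"
  using assms by (auto simp: simplicial_bd_def insert_Diff_if)

lemma simplicial_bd_cong:
  assumes "\<And>x. x \<in> A \<Longrightarrow> x \<notin> J \<Longrightarrow> z (insert x J) = z' (insert x J)"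
  shows "simplicial_bd A z J = simplicial_bd A z' J"
  unfolding simplicial_bd_def by (rule sum.cong) (use assms in auto)

text \<open>The independence complex of the contraction \<open>\<mu>/S\<close> restricted to \<open>A\<close> has vanishing reduced
  mod 2 homology below its top dimension. If \<open>e\<close> is a coloop, the complex is a cone with apex \<open>e\<close>;
  otherwise the link of \<open>e\<close> is filled in \<open>\<mu>/(S \<union> {e})\<close>, which moves the cycle off \<open>e\<close>.\<close>

lemma fill_cycle:
  assumes "matroid_rank F \<mu>" "A \<inter> S = {}" "A \<union> S \<subseteq> F"
    and "\<And>I. z I \<noteq> 0 \<Longrightarrow> I \<subseteq> A \<and> card I = j \<and> \<mu> (I \<union> S) = j + card S"
    and "\<And>J. simplicial_bd A z J = 0"
    and "j + card S < \<mu> (A \<union> S)"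
  shows "\<exists>w. (\<forall>I. w I \<noteq> 0 \<longrightarrow> I \<subseteq> A \<and> card I = Suc j \<and> \<mu> (I \<union> S) = Suc j + card S) \<and>
    (\<forall>J. simplicial_bd A w J = z J)"
proof -
  note M = matroid_rankD[OF assms(1)]
  have "finite A" using M(1) assms(3) finite_subset by blast
  then show ?thesis using assms(2-)
  proof (induction A arbitrary: S z j rule: finite_induct)
    case empty
    then have "\<mu> S \<le> card S" using M(2)[of S] by simp
    then show ?case using empty by simp
  next
    case (insert e A)
    have finS: "finite S" using M(1) insert.prems finite_subset by blast
    have eS: "e \<notin> S" "e \<in> F" "A \<subseteq> F" "S \<subseteq> F" "A \<inter> S = {}" using insert.prems by auto
    have bd: "simplicial_bd A z J = (if e \<in> J then 0 else z (insert e J))" for J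
      using insert.prems(4)[of J] insert.hyps
      by (auto simp: simplicial_bd_insert bit_add_eq_0)
    have card_eS: "card (insert e S) = Suc (card S)" using finS eS by simp
    show ?case
    proof (cases "\<mu> (A \<union> S) \<le> j + card S")
      case True
      define w where "w I = (if e \<in> I \<and> I \<subseteq> insert e A then z (I - {e}) else 0)" for I
      have "I \<subseteq> insert e A \<and> card I = Suc j \<and> \<mu> (I \<union> S) = Suc j + card S" if "w I \<noteq> 0" for I
      proof -
        from that have I: "e \<in> I" "I \<subseteq> insert e A" "z (I - {e}) \<noteq> 0"
          by (auto simp: w_def split: if_splits)
        from insert.prems(3)[OF I(3)]
        have z: "card (I - {e}) = j" "\<mu> (I - {e} \<union> S) = j + card S" by auto
        have finI: "finite I" using I insert.hyps finite_subset by blast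
        have cardI: "card I = Suc j" using z(1) I(1) finI by (metis card_Suc_Diff1)
        \<comment> \<open>Adding \<open>e\<close> raises the rank of \<open>A \<union> S\<close>;
          submodularity transfers this gain to the smaller set \<open>I - {e} \<union> S\<close>, so
          the simplices of the cone are independent.\<close>
        have sub: "\<mu> (A \<union> S \<union> (I \<union> S)) + \<mu> ((A \<union> S) \<inter> (I \<union> S)) \<le> \<mu> (A \<union> S) + \<mu> (I \<union> S)"
          by (rule M(4)) (use eS I in auto)
        have sets: "A \<union> S \<union> (I \<union> S) = insert e A \<union> S" "(A \<union> S) \<inter> (I \<union> S) = I - {e} \<union> S"
          using I eS insert.hyps by auto
        have "Suc j + card S \<le> \<mu> (I \<union> S)"
          using True insert.prems(5) sub[unfolded sets z(2)] by linarith
        moreover have "\<mu> (I \<union> S) \<le> card (I \<union> S)" by (rule M(2)) (use eS I in auto)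
        moreover have "card (I \<union> S) \<le> card I + card S" by (rule card_Un_le)
        ultimately have "\<mu> (I \<union> S) = Suc j + card S" using cardI by linarith
        then show ?thesis using I cardI by blast
      qed
      moreover have "simplicial_bd (insert e A) w J = z J" for J
      proof (cases "e \<in> J")
        case True
        show ?thesis
        proof (cases "J \<subseteq> insert e A")
          case J: True
          have "simplicial_bd A w J = simplicial_bd A z (J - {e})"
            unfolding simplicial_bd_def
          proof (rule sum.cong)
            show "A - J = A - (J - {e})" using insert.hyps by auto
            fix x assume "x \<in> A - (J - {e})"
            then have "x \<in> A" "x \<noteq> e" using insert.hyps by auto
            then have "insert x J - {e} = insert x (J - {e})" "insert x J \<subseteq> insert e A"
              using J by blast+
            then show "w (insert x J) = z (insert x (J - {e}))"
              using True by (simp only: w_def insert_iff) simp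
          qed
          also have "\<dots> = z J" using True by (simp add: bd insert_absorb)
          finally show ?thesis using True insert.hyps by (simp add: simplicial_bd_insert)
        next
          case J: False
          then have "simplicial_bd A w J = 0"
            by (auto simp: simplicial_bd_def w_def)
          moreover have "z J = 0" using J insert.prems(3) by blast
          ultimately show ?thesis using True insert.hyps by (simp add: simplicial_bd_insert)
        qed
      next
        case False
        have "simplicial_bd A w J = 0"
          unfolding simplicial_bd_def
          by (rule sum.neutral) (use False insert.hyps in \<open>auto simp: w_def\<close>)
        moreover have "w (insert e J) = z J"
          using False insert.prems(3)[of J] by (auto simp: w_def)
        ultimately show ?thesis using False insert.hyps by (simp add: simplicial_bd_insert)
      qed
      ultimately show ?thesis by blast
    next
      case False
      define z1 where "z1 I = (if e \<notin> I then z (insert e I) else 0)" for I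
      have z1: "I \<subseteq> A \<and> Suc (card I) = j \<and> \<mu> (I \<union> insert e S) = j + card S" if "z1 I \<noteq> 0" for I
      proof -
        from that have I: "e \<notin> I" "z (insert e I) \<noteq> 0"
          by (auto simp: z1_def split: if_splits)
        from insert.prems(3)[OF I(2)] I(1)
        have "I \<subseteq> A" "card (insert e I) = j" "\<mu> (I \<union> insert e S) = j + card S" by auto
        moreover have "finite I" using calculation(1) insert.hyps finite_subset by blast
        ultimately show ?thesis using I by simp
      qed
      have "\<exists>w1. (\<forall>I. w1 I \<noteq> 0 \<longrightarrow> I \<subseteq> A \<and> card I = j \<and> \<mu> (I \<union> insert e S) = Suc j + card S) \<and>
        (\<forall>J. simplicial_bd A w1 J = z1 J)"
      proof (cases j)
        \<comment> \<open>A chain of degree 0 lives on the empty set, which does not contain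
          \<open>e\<close>, so there is no link to fill.\<close>
        case 0
        then have "z1 = (\<lambda>I. 0)" using z1 by fastforce
        then show ?thesis by (intro exI[of _ "\<lambda>I. 0"]) (simp add: simplicial_bd_def)
      next
        case (Suc j')
        have "\<exists>w. (\<forall>I. w I \<noteq> 0 \<longrightarrow> I \<subseteq> A \<and> card I = Suc j' \<and> \<mu> (I \<union> insert e S) = Suc j' + card (insert e S)) \<and>
           (\<forall>J. simplicial_bd A w J = z1 J)"
        proof (rule insert.IH)
          show "A \<inter> insert e S = {}" "A \<union> insert e S \<subseteq> F" using eS insert.hyps by auto
          show "I \<subseteq> A \<and> card I = j' \<and> \<mu> (I \<union> insert e S) = j' + card (insert e S)" if "z1 I \<noteq> 0" for I
            using z1[OF that] Suc card_eS by simp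
          show "simplicial_bd A z1 J = 0" for J
          proof (cases "e \<in> J")
            case True
            then show ?thesis by (simp add: simplicial_bd_def z1_def)
          next
            case False
            then have "simplicial_bd A z1 J = simplicial_bd A z (insert e J)"
              unfolding simplicial_bd_def
              by (intro sum.cong) (use insert.hyps in \<open>auto simp: z1_def insert_commute\<close>)
            then show ?thesis by (simp add: bd)
          qed
          show "j' + card (insert e S) < \<mu> (A \<union> insert e S)"
            using insert.prems(5) Suc card_eS by simp
        qed
        then show ?thesis using Suc card_eS by simp
      qed
      then obtain w1 where w1: "\<And>I. w1 I \<noteq> 0 \<Longrightarrow> I \<subseteq> A \<and> card I = j \<and> \<mu> (I \<union> insert e S) = Suc j + card S"
        "\<And>J. simplicial_bd A w1 J = z1 J" by blast
      \<comment> \<open>The boundary of the cone over \<open>w1\<close> with apex \<open>e\<close>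
        is \<open>w1\<close> plus the cone over \<open>z1\<close>. Adding it to \<open>z\<close>
        cancels all simplices through \<open>e\<close> and leaves \<open>z2\<close>; the cone
        together with a filling of \<open>z2\<close> in \<open>A\<close> then fills
        \<open>z\<close>.\<close>
      define z2 where "z2 I = (if e \<in> I then 0 else z I + w1 I)" for I
      have "\<exists>w2. (\<forall>I. w2 I \<noteq> 0 \<longrightarrow> I \<subseteq> A \<and> card I = Suc j \<and> \<mu> (I \<union> S) = Suc j + card S) \<and>
        (\<forall>J. simplicial_bd A w2 J = z2 J)"
      proof (rule insert.IH)
        show "A \<inter> S = {}" "A \<union> S \<subseteq> F" using eS by auto
        show "I \<subseteq> A \<and> card I = j \<and> \<mu> (I \<union> S) = j + card S" if "z2 I \<noteq> 0" for I
        proof (cases "z I = 0")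
          case False
          moreover have "e \<notin> I" using that by (auto simp: z2_def)
          ultimately show ?thesis using insert.prems(3)[of I] by auto
        next
          case True
          then have "w1 I \<noteq> 0" using that by (auto simp: z2_def split: if_splits)
          from w1(1)[OF this] have I: "I \<subseteq> A" "card I = j" "\<mu> (I \<union> insert e S) = Suc j + card S" by auto
          have finI: "finite I" using I(1) insert.hyps finite_subset by blast
          have cards: "card (I \<union> insert e S) = Suc j + card S" "card (I \<union> S) = j + card S"
            using I eS insert.hyps finS finI
            by (subst card_Un_disjoint; auto)+
          have "\<mu> (I \<union> S) = card (I \<union> S)"
            by (rule independent_subset[OF assms(1), of "I \<union> insert e S"]) (use I cards eS in auto)
          then show ?thesis using I cards by simp
        qed
        show "simplicial_bd A z2 J = 0" for J
        proof (cases "e \<in> J")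
          case True
          then show ?thesis by (simp add: simplicial_bd_def z2_def)
        next
          case False
          then have "simplicial_bd A z2 J = simplicial_bd A z J + simplicial_bd A w1 J"
            using insert.hyps unfolding simplicial_bd_def sum.distrib[symmetric]
            by (intro sum.cong) (auto simp: z2_def)
          then show ?thesis using False by (simp add: bd w1(2) z1_def)
        qed
        show "j + card S < \<mu> (A \<union> S)" using False by simp
      qed
      then obtain w2 where w2: "\<And>I. w2 I \<noteq> 0 \<Longrightarrow> I \<subseteq> A \<and> card I = Suc j \<and> \<mu> (I \<union> S) = Suc j + card S"
        "\<And>J. simplicial_bd A w2 J = z2 J" by blast
      define w where "w I = (if e \<in> I then w1 (I - {e}) else w2 I)" for I
      have "I \<subseteq> insert e A \<and> card I = Suc j \<and> \<mu> (I \<union> S) = Suc j + card S" if "w I \<noteq> 0" for I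
      proof (cases "e \<in> I")
        case True
        then have "w1 (I - {e}) \<noteq> 0" using that by (simp add: w_def)
        from w1(1)[OF this] have I: "I - {e} \<subseteq> A" "card (I - {e}) = j"
          "\<mu> (I - {e} \<union> insert e S) = Suc j + card S" by auto
        have "finite I" using I(1) insert.hyps by (metis finite_Diff2 finite_subset finite.intros)
        then have "card I = Suc j" using I True by (metis card_Suc_Diff1)
        moreover have "I - {e} \<union> insert e S = I \<union> S" using True by auto
        ultimately show ?thesis using I by auto
      next
        case False
        then show ?thesis using that w2(1)[of I] by (auto simp: w_def)
      qed
      moreover have "simplicial_bd (insert e A) w J = z J" for J
      proof (cases "e \<in> J")
        case True
        have "simplicial_bd A w J = simplicial_bd A w1 (J - {e})"
          unfolding simplicial_bd_def
        proof (rule sum.cong)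
          show "A - J = A - (J - {e})" using insert.hyps by auto
          fix x assume "x \<in> A - (J - {e})"
          then have "insert x J - {e} = insert x (J - {e})" using insert.hyps by blast
          then show "w (insert x J) = w1 (insert x (J - {e}))"
            using True by (simp only: w_def insert_iff) simp
        qed
        also have "\<dots> = z J" using True by (simp add: w1(2) z1_def insert_absorb)
        finally show ?thesis using True insert.hyps by (simp add: simplicial_bd_insert)
      next
        case False
        have "simplicial_bd A w J = simplicial_bd A w2 J"
          by (rule simplicial_bd_cong) (use False insert.hyps in \<open>auto simp: w_def\<close>)
        also have "\<dots> = z J + w1 J" using False by (simp add: w2(2) z2_def)
        finally show ?thesis using False insert.hyps
          by (simp add: simplicial_bd_insert w_def algebra_simps)
      qed
      ultimately show ?thesis by blast
    qed
  qed
qed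

subsection \<open>Sign crossings of vectors in general position\<close>

text \<open>\<open>y i l\<close> is coordinate \<open>l\<close> of the vector with index
  \<open>i\<close>. The equations place the combination in the subspace of codimension
  \<open>m\<close> of a coordinate flag, so a positive solution means that a nontrivial nonnegative
  combination of the vectors reaches this subspace.\<close>

definition kernel_on :: "('i \<Rightarrow> nat \<Rightarrow> real) \<Rightarrow> nat \<Rightarrow> 'i set \<Rightarrow> ('i \<Rightarrow> real) \<Rightarrow> bool" where
  "kernel_on y m I t \<longleftrightarrow> (\<forall>l<m. (\<Sum>i\<in>I. t i * y i l) = 0)"

definition positive_kernel_on :: "('i \<Rightarrow> nat \<Rightarrow> real) \<Rightarrow> nat \<Rightarrow> 'i set \<Rightarrow> ('i \<Rightarrow> real) \<Rightarrow> bool" where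
  "positive_kernel_on y m I t \<longleftrightarrow> kernel_on y m I t \<and> (\<forall>i\<in>I. 0 \<le> t i) \<and> (\<exists>i\<in>I. t i \<noteq> 0)"

text \<open>General position with respect to the flag: for each finite \<open>J\<close> of size at
  most \<open>n\<close>, the square matrix of the first \<open>card J\<close> coordinates is
  nonsingular.\<close>

definition generic :: "('i \<Rightarrow> nat \<Rightarrow> real) \<Rightarrow> nat \<Rightarrow> 'i set \<Rightarrow> bool" where
  "generic y n I \<longleftrightarrow> (\<forall>J t. J \<subseteq> I \<and> card J \<le> n \<and> kernel_on y (card J) J t \<longrightarrow> (\<forall>i\<in>J. t i = 0))"

text \<open>Intersection number with half of a flag subspace: a simplex with m + 1 vertices is
  tested against the subspace of codimension m, cut down to its open half where coordinate m is
  positive.\<close>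

definition crossing :: "('i \<Rightarrow> nat \<Rightarrow> real) \<Rightarrow> 'i set \<Rightarrow> bit" where
  "crossing y J = of_bool (\<exists>t. positive_kernel_on y (card J - 1) J t \<and>
     (\<Sum>i\<in>J. t i * y i (card J - 1)) > 0)"

lemma underdetermined:
  fixes y :: "'i \<Rightarrow> nat \<Rightarrow> real"
  assumes "finite J" "m < card J"
  shows "\<exists>t. kernel_on y m J t \<and> (\<exists>i\<in>J. t i \<noteq> 0)"
  using assms
proof (induction m arbitrary: J)
  case 0
  then obtain j where "j \<in> J" by (metis card.empty ex_in_conv less_irrefl)
  then show ?case by (intro exI[of _ "\<lambda>_. 1"]) (auto simp: kernel_on_def)
next
  case (Suc m)
  then obtain j where j: "j \<in> J" by (metis card.empty ex_in_conv not_less_zero)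
  have sub: "finite (J - {j})" "m < card (J - {j})"
    using Suc.prems j by auto
  obtain t where t: "kernel_on y m (J - {j}) t" "\<exists>i\<in>J - {j}. t i \<noteq> 0"
    using Suc.IH[OF sub] by blast
  define f where "f s = (\<Sum>i\<in>J. s i * y i m)" for s
  have ex: "\<exists>i. i \<noteq> j \<and> i \<in> J \<and> t i \<noteq> 0" using t(2) by auto
  then obtain i where i: "i \<noteq> j" "i \<in> J" "t i \<noteq> 0" by blast
  define t' where "t' = t(j := 0)"
  have t': "kernel_on y m J t'" "t' i \<noteq> 0" "t' j = 0"
    using t(1) j Suc.prems(1) i
    by (auto simp: kernel_on_def t'_def sum.remove)
  have sub2: "finite (J - {i})" "m < card (J - {i})"
    using Suc.prems i by auto
  obtain r where r: "kernel_on y m (J - {i}) r" "\<exists>i'\<in>J - {i}. r i' \<noteq> 0"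
    using Suc.IH[OF sub2] by blast
  define r' where "r' = r(i := 0)"
  obtain h where h: "h \<in> J" "h \<noteq> i" "r' h \<noteq> 0"
    using r(2) by (auto simp: r'_def)
  have r': "kernel_on y m J r'" "r' i = 0"
    using r(1) i(2) Suc.prems(1)
    by (auto simp: kernel_on_def r'_def sum.remove[of J i])
  \<comment> \<open>\<open>r'\<close> vanishes at \<open>i\<close> and \<open>t'\<close> does not,
    so these are independent solutions of the first \<open>m\<close> equations; \<open>s\<close> is
    the combination that also solves the next one.\<close>
  define s where "s k = f r' * t' k - f t' * r' k" for k
  have lin: "(\<Sum>k\<in>J. s k * y k l) = f r' * (\<Sum>k\<in>J. t' k * y k l) - f t' * (\<Sum>k\<in>J. r' k * y k l)" for l
    by (simp add: s_def sum_subtractf sum_distrib_left algebra_simps)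
  have s: "kernel_on y (Suc m) J s"
    using t'(1) r'(1) lin by (auto simp: kernel_on_def less_Suc_eq f_def)
  show ?case
  proof (cases "f r' = 0")
    case True
    then have "kernel_on y (Suc m) J r'"
      using r'(1) by (auto simp: kernel_on_def less_Suc_eq f_def)
    then show ?thesis using h by blast
  next
    case False
    then have "s i \<noteq> 0" using t'(2) r'(2) by (simp add: s_def)
    then show ?thesis using s i(2) by blast
  qed
qed

lemma kernel_on_lincomb:
  assumes "kernel_on y m I s" "kernel_on y m I t"
  shows "kernel_on y m I (\<lambda>i. a * s i + b * t i)"
proof -
  have "(\<Sum>i\<in>I. (a * s i + b * t i) * y i l) = a * (\<Sum>i\<in>I. s i * y i l) + b * (\<Sum>i\<in>I. t i * y i l)" for l
    by (simp add: sum.distrib sum_distrib_left algebra_simps)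
  then show ?thesis using assms by (simp add: kernel_on_def)
qed

lemma kernel_on_remove:
  assumes "finite I" "s x = 0"
  shows "kernel_on y m (I - {x}) s \<longleftrightarrow> kernel_on y m I s"
  using assms by (cases "x \<in> I") (simp_all add: kernel_on_def sum.remove)

lemma kernel_on_cong:
  assumes "\<And>i. i \<in> I \<Longrightarrow> s i = t i"
  shows "kernel_on y m I s \<longleftrightarrow> kernel_on y m I t"
  using assms by (simp add: kernel_on_def)

text \<open>Two linearly independent solutions would combine to one with a zero coordinate.\<close>

lemma generic_proportional:
  assumes "generic y n I" "finite I" "card I = Suc m" "m \<le> n"
    and "kernel_on y m I s" "kernel_on y m I t" "i \<in> I" "t i \<noteq> 0" "j \<in> I"
  shows "s j = s i / t i * t j"
proof -
  define r where "r k = 1 * s k + (- (s i / t i)) * t k" for k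
  have "kernel_on y m I r"
    unfolding r_def using assms by (intro kernel_on_lincomb)
  moreover have "r i = 0" using assms by (simp add: r_def)
  ultimately have "kernel_on y m (I - {i}) r"
    using assms by (simp add: kernel_on_remove)
  moreover have "card (I - {i}) = m" using assms by simp
  ultimately have "\<forall>j\<in>I - {i}. r j = 0"
    using assms(1,4) unfolding generic_def by (metis Diff_subset)
  then have "r j = 0" using \<open>r i = 0\<close> assms by (cases "j = i") auto
  then show ?thesis by (simp add: r_def)
qed

lemma generic_nonzero:
  assumes "generic y n I" "finite I" "card I = Suc m" "m \<le> n"
    and "kernel_on y m I t" "i \<in> I" "t i \<noteq> 0" "j \<in> I"
  shows "t j \<noteq> 0"
proof
  assume "t j = 0"
  then have "kernel_on y m (I - {j}) t" using assms by (simp add: kernel_on_remove)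
  moreover have "card (I - {j}) = m" using assms by simp
  ultimately have "\<forall>j'\<in>I - {j}. t j' = 0"
    using assms(1,4) unfolding generic_def by (metis Diff_subset)
  then show False using assms \<open>t j = 0\<close> by (cases "i = j") auto
qed

lemma generic_mono: "generic y n I \<Longrightarrow> J \<subseteq> I \<Longrightarrow> generic y n J"
  unfolding generic_def by (meson subset_trans)

lemma positive_kernel_on_uminus [simp]:
  "positive_kernel_on (\<lambda>i l. - y i l) m I t \<longleftrightarrow> positive_kernel_on y m I t"
  by (simp add: positive_kernel_on_def kernel_on_def sum_negf)

text \<open>By genericity the solutions form a line on which coordinate \<open>m\<close> is nonzero.
  All positive solutions lie on one ray of it, so exactly one of the two opposite half-spaces is hit
  if there is a positive solution at all.\<close>

lemma crossing_antipodal: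
  assumes "generic y n I" "finite I" "card I = Suc m" "m < n"
  shows "crossing y I + crossing (\<lambda>i l. - y i l) I = of_bool (\<exists>t. positive_kernel_on y m I t)"
proof (cases "\<exists>t. positive_kernel_on y m I t")
  case False
  then show ?thesis using assms(3) by (simp add: crossing_def)
next
  case True
  then obtain t i where t: "kernel_on y m I t" "\<forall>i\<in>I. 0 \<le> t i" "i \<in> I" "t i \<noteq> 0"
    by (auto simp: positive_kernel_on_def)
  define f where "f s = (\<Sum>i\<in>I. s i * y i m)" for s
  have "f t \<noteq> 0"
  proof
    assume "f t = 0"
    then have "kernel_on y (Suc m) I t" using t(1) by (auto simp: kernel_on_def f_def less_Suc_eq)
    then show False using assms t unfolding generic_def by (metis Suc_leI order_refl)
  qed
  have f: "\<exists>c>0. f s = c * f t" if "positive_kernel_on y m I s" for s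
  proof (intro exI conjI)
    obtain k where s: "kernel_on y m I s" "\<forall>i\<in>I. 0 \<le> s i" "k \<in> I" "s k \<noteq> 0"
      using \<open>positive_kernel_on y m I s\<close> by (auto simp: positive_kernel_on_def)
    have eq: "s j = s i / t i * t j" if "j \<in> I" for j
      using generic_proportional[OF assms(1-3) _ s(1) t(1,3,4) that] assms by simp
    have "s i \<noteq> 0" using eq[OF s(3)] s(4) by auto
    then show "s i / t i > 0" using s(2) t(2,3,4)
      by (metis divide_pos_pos less_eq_real_def)
    show "f s = s i / t i * f t"
      unfolding f_def sum_distrib_left by (rule sum.cong) (use eq in \<open>auto simp: algebra_simps\<close>)
  qed
  have c1: "crossing y I = of_bool (f t > 0)"
  proof -
    have "(\<exists>s. positive_kernel_on y m I s \<and> f s > 0) \<longleftrightarrow> f t > 0"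
      using f t by (metis positive_kernel_on_def zero_less_mult_pos)
    then show ?thesis by (simp add: crossing_def assms(3) f_def)
  qed
  have c2: "crossing (\<lambda>i l. - y i l) I = of_bool (f t < 0)"
  proof -
    have "(\<exists>s. positive_kernel_on y m I s \<and> f s < 0) \<longleftrightarrow> f t < 0"
      using f t by (metis positive_kernel_on_def mult_less_0_iff less_asym)
    then show ?thesis
      by (simp add: crossing_def assms(3) f_def sum_negf)
  qed
  show ?thesis using \<open>f t \<noteq> 0\<close> True by (auto simp: c1 c2)
qed

text \<open>The nonnegative solutions of \<open>m\<close> equations in \<open>m + 2\<close> unknowns form a two-dimensional cone.
  Starting from the solution on one extreme ray, i.e. on one facet, the pivot step reaches
  exactly one other facet.\<close>

lemma pivot:
  assumes gen: "generic y n I" and fin: "finite I" and card: "card I = Suc (Suc m)" and "m < n"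
    and x: "x \<in> I" and pos: "positive_kernel_on y m (I - {x}) t0"
  shows "\<exists>z t t'. z \<in> I \<and> z \<noteq> x \<and> positive_kernel_on y m (I - {x}) t \<and> t x = 0 \<and>
    positive_kernel_on y m (I - {z}) t' \<and> t' z = 0 \<and>
    (\<forall>w s. w \<in> I \<and> positive_kernel_on y m (I - {w}) s \<longrightarrow> w = x \<or> w = z) \<and>
    (\<forall>s. positive_kernel_on y m I s \<longrightarrow>
       (\<exists>a b. 0 \<le> a \<and> 0 \<le> b \<and> (0 < a \<or> 0 < b) \<and> (\<forall>i\<in>I. s i = a * t i + b * t' i)))"
proof -
  have gen': "generic y n (I - {j})" for j using gen generic_mono by blast
  have card': "card (I - {j}) = Suc m" if "j \<in> I" for j using that card by simp
  define t where "t = t0(x := 0)"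
  have t0: "kernel_on y m (I - {x}) t0" "\<forall>i\<in>I - {x}. 0 \<le> t0 i" "\<exists>i\<in>I - {x}. t0 i \<noteq> 0"
    using pos by (auto simp: positive_kernel_on_def)
  have tx: "t x = 0" by (simp add: t_def)
  have tk': "kernel_on y m (I - {x}) t"
    using t0(1) by (subst kernel_on_cong[of _ _ t0]) (auto simp: t_def)
  then have tk: "kernel_on y m I t" using fin tx by (simp add: kernel_on_remove)
  obtain i0 where i0: "i0 \<in> I - {x}" "t i0 \<noteq> 0" using t0(3) by (auto simp: t_def)
  have tpos: "t i > 0" if "i \<in> I - {x}" for i
  proof -
    have "t i \<noteq> 0"
      by (rule generic_nonzero[OF gen' _ card' _ tk' i0 that]) (use fin x \<open>m < n\<close> in auto)
    then show ?thesis using that t0(2) by (auto simp: t_def order_less_le)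
  qed
  have "\<exists>r. kernel_on y m I r \<and> r x = 1"
  proof -
    obtain k i where k: "kernel_on y m (I - {i0}) k" "i \<in> I - {i0}" "k i \<noteq> 0"
      using underdetermined[of "I - {i0}" m y] fin card'[of i0] i0 by auto
    have kx: "k x \<noteq> 0"
      by (rule generic_nonzero[OF gen' _ card' _ k]) (use fin x i0 \<open>m < n\<close> in auto)
    define k' where "k' = k(i0 := 0)"
    have "kernel_on y m (I - {i0}) k'"
      using k(1) by (subst kernel_on_cong[of _ _ k]) (auto simp: k'_def)
    then have "kernel_on y m I k'" using fin by (simp add: kernel_on_remove k'_def)
    from kernel_on_lincomb[OF this this, of "1 / k x" 0]
    show ?thesis using kx i0 by (intro exI[of _ "\<lambda>i. 1 / k x * k' i + 0 * k' i"]) (auto simp: k'_def)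
  qed
  then obtain r where r: "kernel_on y m I r" "r x = 1" by blast
  have span: "\<exists>a. \<forall>i\<in>I. s i = s x * r i + a * t i" if s: "kernel_on y m I s" for s
  proof -
    define q where "q i = 1 * s i + (- s x) * r i" for i
    have q: "kernel_on y m I q" unfolding q_def by (rule kernel_on_lincomb[OF s r(1)])
    have qx: "q x = 0" by (simp add: q_def r)
    have qk: "kernel_on y m (I - {x}) q" using q qx fin by (simp add: kernel_on_remove)
    have qt: "q j = q i0 / t i0 * t j" if "j \<in> I - {x}" for j
      by (rule generic_proportional[OF gen' _ card' _ qk tk' i0 that]) (use fin x \<open>m < n\<close> in auto)
    have "s j = s x * r j + (q i0 / t i0) * t j" if "j \<in> I" for j
    proof (cases "j = x")
      case True then show ?thesis using r tx by simp
    next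
      case False
      then show ?thesis using qt[of j] that by (simp add: q_def)
    qed
    then show ?thesis by blast
  qed
  \<comment> \<open>A nonzero solution has at most one zero entry, because \<open>m\<close> vectors
    in general position satisfy only the trivial relation.\<close>
  have two_zeros: "s w \<noteq> 0" if "kernel_on y m I s" "w \<in> I" "z \<in> I" "w \<noteq> z" "s z = 0" "i \<in> I" "s i \<noteq> 0"
    for s w z i
  proof -
    have "kernel_on y m (I - {z}) s" using that fin by (simp add: kernel_on_remove)
    from generic_nonzero[OF gen' _ card' _ this, of i w] show ?thesis
      using that fin \<open>m < n\<close> by (metis DiffI finite_Diff less_imp_le singletonD)
  qed
  \<comment> \<open>The ratio test of the simplex method: \<open>a\<close> is the least multiple of
    \<open>t\<close> that makes \<open>r\<close> plus it nonnegative off \<open>x\<close>, and an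
    index attaining the maximum drops to zero. This index is the other facet.\<close>
  define a where "a = Max ((\<lambda>i. - r i / t i) ` (I - {x}))"
  have ne: "I - {x} \<noteq> {}" using i0 by auto
  have finImg: "finite ((\<lambda>i. - r i / t i) ` (I - {x}))" using fin by simp
  have "a \<in> (\<lambda>i. - r i / t i) ` (I - {x})"
    unfolding a_def by (rule Max_in) (use finImg ne in auto)
  then obtain z where z: "z \<in> I - {x}" "a = - r z / t z" by blast
  have amax: "- r i / t i \<le> a" if "i \<in> I - {x}" for i
    unfolding a_def by (rule Max_ge) (use finImg that in auto)
  define t' where "t' i = 1 * r i + a * t i" for i
  have t'k: "kernel_on y m I t'" unfolding t'_def by (rule kernel_on_lincomb[OF r(1) tk])
  have t'z: "t' z = 0" using z tpos[OF z(1)] by (simp add: t'_def)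
  have t'x: "t' x = 1" using r tx by (simp add: t'_def)
  have t'nn: "0 \<le> t' i" if "i \<in> I" for i
  proof (cases "i = x")
    case False
    then have i: "i \<in> I - {x}" using that by simp
    have "- r i \<le> a * t i" using amax[OF i] tpos[OF i] by (metis pos_divide_le_eq)
    then show ?thesis by (simp add: t'_def)
  qed (simp add: t'x)
  \<comment> \<open>The two coefficients are read off at \<open>x\<close>, where \<open>t\<close> is
    0 and \<open>t'\<close> is 1, and at \<open>z\<close>, where \<open>t'\<close> is 0 and
    \<open>t\<close> is positive.\<close>
  have decomp: "\<exists>b. 0 \<le> b \<and> (\<forall>i\<in>I. s i = s x * t' i + b * t i)"
    if s: "kernel_on y m I s" "\<forall>i\<in>I. 0 \<le> s i" for s
  proof -
    obtain c where c: "\<forall>i\<in>I. s i = s x * r i + c * t i" using span[OF s(1)] by blast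
    have zI: "z \<in> I" using z by simp
    have "0 \<le> s x * r z + c * t z" using c s(2) zI by metis
    moreover have "r z = - a * t z" using z tpos[OF z(1)] by simp
    ultimately have "0 \<le> (c - s x * a) * t z" by (simp add: algebra_simps)
    then have "0 \<le> c - s x * a" using tpos[OF z(1)] by (simp add: zero_le_mult_iff)
    moreover have "s i = s x * t' i + (c - s x * a) * t i" if "i \<in> I" for i
      using c that by (simp add: t'_def algebra_simps)
    ultimately show ?thesis by blast
  qed
  have P1: "positive_kernel_on y m (I - {x}) t"
    using tk' i0 tpos by (auto simp: positive_kernel_on_def less_imp_le)
  have P2: "positive_kernel_on y m (I - {z}) t'"
  proof -
    have "kernel_on y m (I - {z}) t'" using t'k t'z fin by (simp add: kernel_on_remove)
    moreover have "x \<in> I - {z}" using x z by auto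
    ultimately show ?thesis using t'nn t'x by (auto simp: positive_kernel_on_def intro!: bexI[of _ x])
  qed
  have only: "w = x \<or> w = z" if w: "w \<in> I" "positive_kernel_on y m (I - {w}) s" for w s
  proof (rule ccontr)
    assume neq: "\<not> (w = x \<or> w = z)"
    define s' where "s' = s(w := 0)"
    have s: "kernel_on y m (I - {w}) s" "\<forall>i\<in>I - {w}. 0 \<le> s i" "\<exists>i\<in>I - {w}. s i \<noteq> 0"
      using w by (auto simp: positive_kernel_on_def)
    have "kernel_on y m (I - {w}) s'"
      using s(1) by (subst kernel_on_cong[of _ _ s]) (auto simp: s'_def)
    then have sk: "kernel_on y m I s'" using fin by (simp add: kernel_on_remove s'_def)
    have snn: "\<forall>i\<in>I. 0 \<le> s' i" using s(2) by (auto simp: s'_def)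
    obtain b where b: "0 \<le> b" "\<forall>i\<in>I. s' i = s' x * t' i + b * t i" using decomp[OF sk snn] by blast
    have "s' w = 0" by (simp add: s'_def)
    then have "s' x * t' w + b * t w = 0" using b(2) w by metis
    moreover have "0 \<le> s' x * t' w" "0 \<le> b * t w"
      using snn x t'nn w b(1) tpos[of w] neq by auto
    ultimately have "s' x * t' w = 0" "b * t w = 0" by linarith+
    moreover have "t w > 0" using tpos w neq by auto
    moreover have "t' w \<noteq> 0"
      by (rule two_zeros[OF t'k w(1), of z x]) (use z neq x t'z t'x in auto)
    ultimately have "s' x = 0" "b = 0" by auto
    then have "\<forall>i\<in>I. s' i = 0" using b(2) by simp
    moreover obtain i where "i \<in> I" "i \<noteq> w" "s i \<noteq> 0" using s(3) by blast
    ultimately show False by (metis fun_upd_other s'_def)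
  qed
  have cone: "\<exists>a b. 0 \<le> a \<and> 0 \<le> b \<and> (0 < a \<or> 0 < b) \<and> (\<forall>i\<in>I. s i = a * t i + b * t' i)"
    if pk: "positive_kernel_on y m I s" for s
  proof -
    obtain i where s: "kernel_on y m I s" "\<forall>i\<in>I. 0 \<le> s i" "i \<in> I" "s i \<noteq> 0"
      using pk unfolding positive_kernel_on_def by blast
    obtain b where b: "0 \<le> b" "\<forall>i\<in>I. s i = s x * t' i + b * t i" using decomp[OF s(1,2)] by blast
    have "0 \<le> s x" using s(2) x by simp
    moreover have "0 < b \<or> 0 < s x"
    proof (rule ccontr)
      assume "\<not> ?thesis"
      then have "b = 0" "s x = 0" using b(1) \<open>0 \<le> s x\<close> by auto
      then show False using b(2) s(3,4) by simp
    qed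
    ultimately show ?thesis using b by (intro exI[of _ b] exI[of _ "s x"]) auto
  qed
  show ?thesis using z P1 tx P2 t'z only cone by (intro exI[of _ z] exI[of _ t] exI[of _ t']) blast
qed

text \<open>An interval crosses zero iff exactly one of its ends is positive. The positive solutions
  of the first \<open>m\<close> equations, if any, form a planar cone whose two extreme rays lie on
  facets. Coordinate \<open>m\<close> is nonzero on both rays, and vanishes somewhere in the cone
  exactly when the signs differ.\<close>

lemma crossing_facets:
  assumes gen: "generic y n I" and fin: "finite I" and card: "card I = Suc (Suc m)" and "m < n"
  shows "(\<Sum>x\<in>I. crossing y (I - {x})) = of_bool (\<exists>t. positive_kernel_on y (Suc m) I t)"
proof -
  define f where "f s = (\<Sum>i\<in>I. s i * y i m)" for s
  have card': "card (I - {j}) = Suc m" if "j \<in> I" for j using that card by simp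
  have gen': "generic y n (I - {j})" for j using gen generic_mono by blast
  show ?thesis
  proof (cases "\<exists>x\<in>I. \<exists>s. positive_kernel_on y m (I - {x}) s")
    case False
    have "crossing y (I - {x}) = 0" if "x \<in> I" for x
      using False that card'[OF that] by (auto simp: crossing_def)
    moreover have "\<not> positive_kernel_on y (Suc m) I t" for t
    proof
      assume "positive_kernel_on y (Suc m) I t"
      then obtain i where t: "kernel_on y m I t" "\<forall>i\<in>I. 0 \<le> t i" "i \<in> I" "t i \<noteq> 0"
        by (auto simp: positive_kernel_on_def kernel_on_def)
      have tpos: "t j > 0" if "j \<in> I" for j
      proof (rule ccontr)
        assume "\<not> t j > 0"
        then have "t j = 0" using t that by force
        then have "positive_kernel_on y m (I - {j}) t"
          using t fin by (auto simp: positive_kernel_on_def kernel_on_remove)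
        then show False using False that by blast
      qed
      obtain k j where k: "kernel_on y m (I - {i}) k" "j \<in> I - {i}" "k j \<noteq> 0"
        using underdetermined[of "I - {i}" m y] fin card'[OF t(3)] by auto
      \<comment> \<open>A second solution that is zero at \<open>i\<close> and scaled to have a
        positive entry. Subtracting the least multiple \<open>c\<close> of it that annihilates an
        entry of \<open>t\<close> leads to a facet, while entry \<open>i\<close> stays
        nonzero.\<close>
      define k' where "k' = (\<lambda>h. if h = i then 0 else k h / k j)"
      have "kernel_on y m (I - {i}) (\<lambda>h. (1 / k j) * k h + 0 * k h)"
        by (rule kernel_on_lincomb) (rule k(1))+
      then have "kernel_on y m (I - {i}) k'"
        by (subst kernel_on_cong[of _ _ "\<lambda>h. (1 / k j) * k h + 0 * k h"]) (auto simp: k'_def)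
      then have k'k: "kernel_on y m I k'" using fin by (simp add: kernel_on_remove k'_def)
      have k'j: "k' j = 1" "j \<in> I" and k'i: "k' i = 0" using k by (auto simp: k'_def)
      define P where "P = {h\<in>I. k' h > 0}"
      define c where "c = Min ((\<lambda>h. t h / k' h) ` P)"
      have P: "finite ((\<lambda>h. t h / k' h) ` P)" "(\<lambda>h. t h / k' h) ` P \<noteq> {}"
        using fin k'j by (auto simp: P_def)
      have "c \<in> (\<lambda>h. t h / k' h) ` P" unfolding c_def by (rule Min_in[OF P])
      then obtain h where h: "h \<in> I" "k' h > 0" "c = t h / k' h" by (auto simp: P_def)
      have cmin: "c \<le> t g / k' g" if "g \<in> I" "k' g > 0" for g
        unfolding c_def by (rule Min_le) (use P that in \<open>auto simp: P_def\<close>)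
      have "c > 0" using h tpos by simp
      define s where "s g = 1 * t g + (- c) * k' g" for g
      have "kernel_on y m I s" unfolding s_def by (rule kernel_on_lincomb[OF t(1) k'k])
      moreover have "s h = 0" using h by (simp add: s_def)
      ultimately have "kernel_on y m (I - {h}) s" using fin by (simp add: kernel_on_remove)
      moreover have "s g \<ge> 0" if "g \<in> I" for g
      proof (cases "k' g > 0")
        case True
        then show ?thesis using cmin[OF that True] by (simp add: s_def pos_le_divide_eq)
      next
        case False
        then have "c * k' g \<le> 0" using \<open>c > 0\<close> by (simp add: mult_le_0_iff)
        then show ?thesis using tpos[OF that] by (simp add: s_def)
      qed
      moreover have "i \<in> I - {h}" using t(3) h(2) k'i by auto
      moreover have "s i \<noteq> 0" using t(4) k'i by (simp add: s_def)
      ultimately have "positive_kernel_on y m (I - {h}) s"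
        by (auto simp: positive_kernel_on_def)
      then show False using False h(1) by blast
    qed
    ultimately show ?thesis by simp
  next
    case True
    then obtain x t0 where x: "x \<in> I" "positive_kernel_on y m (I - {x}) t0" by blast
    from pivot[OF assms x] obtain z t t' where
      z: "z \<in> I" "z \<noteq> x" and t: "positive_kernel_on y m (I - {x}) t" "t x = 0"
      and t': "positive_kernel_on y m (I - {z}) t'" "t' z = 0"
      and only: "\<And>w s. w \<in> I \<Longrightarrow> positive_kernel_on y m (I - {w}) s \<Longrightarrow> w = x \<or> w = z"
      and cone: "\<And>s. positive_kernel_on y m I s \<Longrightarrow>
       \<exists>a b. 0 \<le> a \<and> 0 \<le> b \<and> (0 < a \<or> 0 < b) \<and> (\<forall>i\<in>I. s i = a * t i + b * t' i)"
      by metis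
    have facet: "f u \<noteq> 0 \<and> crossing y (I - {w}) = of_bool (f u > 0)"
      if w: "w \<in> I" "positive_kernel_on y m (I - {w}) u" "u w = 0" for w u
    proof -
      have fin': "finite (I - {w})" using fin by simp
      obtain i where u: "kernel_on y m (I - {w}) u" "\<forall>i\<in>I - {w}. 0 \<le> u i" "i \<in> I - {w}" "u i \<noteq> 0"
        using w by (auto simp: positive_kernel_on_def)
      have fu: "(\<Sum>i\<in>I - {w}. u i * y i m) = f u"
        using fin w by (simp add: f_def sum.remove)
      have "f u \<noteq> 0"
      proof
        assume "f u = 0"
        then have "kernel_on y (Suc m) (I - {w}) u"
          using u(1) fu by (auto simp: kernel_on_def less_Suc_eq)
        then show False using gen' u(3,4) card'[OF w(1)] \<open>m < n\<close> unfolding generic_def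
          by (metis Suc_leI order_refl)
      qed
      moreover have "(\<exists>s. positive_kernel_on y m (I - {w}) s \<and> (\<Sum>i\<in>I - {w}. s i * y i m) > 0) \<longleftrightarrow> f u > 0"
      proof
        assume "f u > 0"
        then show "\<exists>s. positive_kernel_on y m (I - {w}) s \<and> (\<Sum>i\<in>I - {w}. s i * y i m) > 0"
          using w fu by auto
      next
        assume "\<exists>s. positive_kernel_on y m (I - {w}) s \<and> (\<Sum>i\<in>I - {w}. s i * y i m) > 0"
        then obtain s where s: "kernel_on y m (I - {w}) s" "\<forall>i\<in>I - {w}. 0 \<le> s i"
          "(\<Sum>i\<in>I - {w}. s i * y i m) > 0" by (auto simp: positive_kernel_on_def)
        have eq: "s j = s i / u i * u j" if "j \<in> I - {w}" for j
          by (rule generic_proportional[OF gen' fin' card'[OF w(1)] _ s(1) u(1,3,4) that])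
            (use \<open>m < n\<close> in simp)
        have "(\<Sum>j\<in>I - {w}. s j * y j m) = s i / u i * f u"
          unfolding fu[symmetric] sum_distrib_left by (rule sum.cong) (use eq in \<open>auto simp: algebra_simps\<close>)
        moreover have "0 \<le> s i / u i" using s u by simp
        ultimately show "f u > 0" using s(3) by (metis not_less_iff_gr_or_eq zero_less_mult_pos mult_zero_left less_eq_real_def)
      qed
      ultimately show ?thesis by (simp add: crossing_def card'[OF w(1)])
    qed
    have "(\<Sum>w\<in>I. crossing y (I - {w})) = (\<Sum>w\<in>{x, z}. crossing y (I - {w}))"
    proof (rule sum.mono_neutral_right[OF fin])
      show "{x, z} \<subseteq> I" using x z by simp
      show "\<forall>w\<in>I - {x, z}. crossing y (I - {w}) = 0"
      proof
        fix w assume w: "w \<in> I - {x, z}"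
        then have "\<nexists>s. positive_kernel_on y m (I - {w}) s" using only by blast
        then show "crossing y (I - {w}) = 0" using w card'[of w] by (simp add: crossing_def)
      qed
    qed
    also have "\<dots> = of_bool (f t > 0) + of_bool (f t' > 0)"
      using z facet[OF x(1) t] facet[OF z(1) t'] by simp
    also have "\<dots> = of_bool (\<exists>s. positive_kernel_on y (Suc m) I s)"
    proof -
      have lin: "f s = a * f t + b * f t'" if "\<forall>i\<in>I. s i = a * t i + b * t' i" for s a b
        using that by (simp add: f_def sum.distrib sum_distrib_left algebra_simps)
      have ft: "f t \<noteq> 0" "f t' \<noteq> 0" using facet[OF x(1) t] facet[OF z(1) t'] by auto
      have iff: "(\<exists>s. positive_kernel_on y (Suc m) I s) \<longleftrightarrow> (f t > 0) \<noteq> (f t' > 0)"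
      proof
        assume "\<exists>s. positive_kernel_on y (Suc m) I s"
        then obtain s where "positive_kernel_on y (Suc m) I s" by blast
        then have s: "positive_kernel_on y m I s" "f s = 0"
          by (simp_all add: positive_kernel_on_def kernel_on_def f_def)
        obtain a b where ab: "0 \<le> a" "0 \<le> b" "0 < a \<or> 0 < b" "\<forall>i\<in>I. s i = a * t i + b * t' i"
          using cone[OF s(1)] by blast
        have eq0: "a * f t + b * f t' = 0" using lin[OF ab(4)] s(2) by simp
        show "(f t > 0) \<noteq> (f t' > 0)"
        proof
          assume same: "(f t > 0) = (f t' > 0)"
          show False
          proof (cases "f t > 0")
            case True
            then have "0 \<le> a * f t" "0 \<le> b * f t'" "0 < a * f t \<or> 0 < b * f t'"
              using same ab by auto
            then show False using eq0 by linarith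
          next
            case False
            then have neg: "f t < 0" "f t' < 0" using same ft by auto
            then have "a * f t \<le> 0" "b * f t' \<le> 0" "a * f t < 0 \<or> b * f t' < 0"
              using ab by (auto simp: mult_less_0_iff mult_le_0_iff)
            then show False using eq0 by linarith
          qed
        qed
      next
        assume opp: "(f t > 0) \<noteq> (f t' > 0)"
        \<comment> \<open>These weights make the two values of opposite sign cancel.\<close>
        define s where "s i = \<bar>f t'\<bar> * t i + \<bar>f t\<bar> * t' i" for i
        have tk: "kernel_on y m I t" "kernel_on y m I t'"
          using t t' fin by (simp_all add: positive_kernel_on_def kernel_on_remove)
        have "kernel_on y m I s" unfolding s_def by (rule kernel_on_lincomb[OF tk])
        moreover have "f s = \<bar>f t'\<bar> * f t + \<bar>f t\<bar> * f t'" by (rule lin) (simp add: s_def)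
        moreover have "\<bar>f t'\<bar> * f t + \<bar>f t\<bar> * f t' = 0" using opp ft by (auto simp: abs_if)
        ultimately have "kernel_on y (Suc m) I s"
          by (auto simp: kernel_on_def f_def less_Suc_eq)
        moreover have nn: "0 \<le> t i \<and> 0 \<le> t' i" if "i \<in> I" for i
          using t t' that unfolding positive_kernel_on_def by (metis DiffI order_refl singletonD)
        then have "\<forall>i\<in>I. 0 \<le> s i" by (simp add: s_def)
        moreover obtain i where i: "i \<in> I" "t i \<noteq> 0" using t by (auto simp: positive_kernel_on_def)
        then have "s i > 0" using nn[OF i(1)] ft unfolding s_def
          by (intro add_pos_nonneg mult_pos_pos mult_nonneg_nonneg) auto
        ultimately show "\<exists>s. positive_kernel_on y (Suc m) I s"
          using i(1) unfolding positive_kernel_on_def by (metis less_irrefl)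
      qed
      show ?thesis unfolding iff by (cases "f t > 0"; cases "f t' > 0") simp_all
    qed
    finally show ?thesis .
  qed
qed

subsection \<open>Perturbation into general position\<close>

lemma finite_line_Int_subspace:
  fixes S :: "'a::real_vector set"
  assumes "subspace S" "d \<notin> S"
  shows "finite {t. w + t *\<^sub>R d \<in> S}"
proof -
  have "t = t'" if "w + t *\<^sub>R d \<in> S" "w + t' *\<^sub>R d \<in> S" for t t'
  proof (rule ccontr)
    assume "t \<noteq> t'"
    have "(t - t') *\<^sub>R d \<in> S"
      using subspace_diff[OF assms(1) that] by (simp add: algebra_simps)
    then have "(1 / (t - t')) *\<^sub>R (t - t') *\<^sub>R d \<in> S" by (rule subspace_scale[OF assms(1)])
    then show False using \<open>t \<noteq> t'\<close> assms(2) by simp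
  qed
  then have "{t. w + t *\<^sub>R d \<in> S} \<subseteq> {t'}" if "w + t' *\<^sub>R d \<in> S" for t' using that by blast
  then show ?thesis by (cases "{t. w + t *\<^sub>R d \<in> S} = {}") (auto intro: finite_subset)
qed

text \<open>The line through \<open>w\<close> in a direction \<open>d\<close> outside all the
  subspaces meets each of them at most once, so arbitrarily small moves avoid them all.\<close>

lemma avoid_subspaces_near:
  fixes W :: "'a::real_normed_vector set"
  assumes "finite \<S>" "\<And>S. S \<in> \<S> \<Longrightarrow> subspace S" "\<And>S. S \<in> \<S> \<Longrightarrow> d \<notin> S"
    and "subspace W" "d \<in> W" "w \<in> W" "\<delta> > 0"
  shows "\<exists>w'\<in>W. norm (w' - w) < \<delta> \<and> (\<forall>S\<in>\<S>. w' \<notin> S)"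
proof -
  have "finite (\<Union>S\<in>\<S>. {t. w + t *\<^sub>R d \<in> S})"
    using assms by (intro finite_UN_I finite_line_Int_subspace) auto
  moreover have "infinite {0<..<\<delta> / (norm d + 1)}"
    using \<open>\<delta> > 0\<close> by (simp add: add_nonneg_pos)
  ultimately have "infinite ({0<..<\<delta> / (norm d + 1)} - (\<Union>S\<in>\<S>. {t. w + t *\<^sub>R d \<in> S}))"
    by (rule Diff_infinite_finite)
  then have "{0<..<\<delta> / (norm d + 1)} - (\<Union>S\<in>\<S>. {t. w + t *\<^sub>R d \<in> S}) \<noteq> {}"
    using infinite_imp_nonempty by blast
  then obtain t where "t \<in> {0<..<\<delta> / (norm d + 1)} - (\<Union>S\<in>\<S>. {t. w + t *\<^sub>R d \<in> S})"
    by blast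
  then have t: "0 < t" "t < \<delta> / (norm d + 1)" "\<forall>S\<in>\<S>. w + t *\<^sub>R d \<notin> S"
    by auto
  have "t * norm d \<le> t * (norm d + 1)" using t(1) by simp
  also have "\<dots> < \<delta>" using t(2) by (simp add: pos_less_divide_eq add_nonneg_pos)
  finally have "norm ((w + t *\<^sub>R d) - w) < \<delta>" using t(1) by simp
  moreover have "w + t *\<^sub>R d \<in> W" using assms by (simp add: subspace_add subspace_scale)
  ultimately show ?thesis using t(3) by blast
qed

lemma avoid_subspaces:
  fixes W :: "'a::real_normed_vector set"
  assumes "finite \<S>" "subspace W" "\<And>S. S \<in> \<S> \<Longrightarrow> subspace S \<and> \<not> W \<subseteq> S"
  shows "\<exists>d\<in>W. \<forall>S\<in>\<S>. d \<notin> S"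
  using assms
proof (induction \<S> rule: finite_induct)
  case empty
  then show ?case using subspace_0 by blast
next
  case (insert S \<S>)
  then obtain w where w: "w \<in> W" "\<forall>S\<in>\<S>. w \<notin> S" by blast
  obtain d where d: "d \<in> W" "d \<notin> S" using insert.prems(2) by blast
  \<comment> \<open>\<open>w\<close> avoids the old subspaces and \<open>d\<close> the new one. For
    nonzero \<open>t\<close>, the point \<open>w + t *\<^sub>R d\<close> lies in an old subspace iff
    \<open>d + inverse t *\<^sub>R w\<close> does, which happens for finitely many \<open>t\<close>
    because \<open>w\<close> is outside; hence the inverses.\<close>
  have "finite ({t. w + t *\<^sub>R d \<in> S} \<union> (\<Union>S\<in>\<S>. {t. d + t *\<^sub>R w \<in> S}))"
    using insert.hyps insert.prems d w by (intro finite_UnI finite_UN_I finite_line_Int_subspace) auto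
  then have "finite ({t. w + t *\<^sub>R d \<in> S} \<union> inverse ` (\<Union>S\<in>\<S>. {t. d + t *\<^sub>R w \<in> S}) \<union> {0})" by simp
  from ex_new_if_finite[OF infinite_UNIV_char_0 this]
  obtain t where t: "t \<noteq> 0" "w + t *\<^sub>R d \<notin> S" "t \<notin> inverse ` (\<Union>S\<in>\<S>. {t. d + t *\<^sub>R w \<in> S})"
    by auto
  have "w + t *\<^sub>R d \<notin> S'" if "S' \<in> \<S>" for S'
  proof
    assume "w + t *\<^sub>R d \<in> S'"
    then have "inverse t *\<^sub>R (w + t *\<^sub>R d) \<in> S'" using that insert.prems by (intro subspace_scale) auto
    then have "d + inverse t *\<^sub>R w \<in> S'" using t(1) by (simp add: algebra_simps)
    then show False using t(1,3) that by (metis (no_types, lifting) UN_I image_eqI inverse_inverse_eq mem_Collect_eq)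
  qed
  then show ?case using t(2) w d insert.prems(1) by (intro bexI[of _ "w + t *\<^sub>R d"]) (auto simp: subspace_add subspace_scale)
qed

lemma sum_mult_inner_eq:
  fixes v :: "'i \<Rightarrow> 'b::real_inner"
  shows "(\<Sum>i\<in>I. t i * (v i \<bullet> x)) = (\<Sum>i\<in>I. t i *\<^sub>R v i) \<bullet> x"
  by (simp add: inner_sum_left)

text \<open>The vectors are moved one at a time. A relation on \<open>insert i J\<close> with
  nonzero coefficient at \<open>i\<close>, whose first \<open>card J + 1\<close> coordinates vanish,
  puts the new vector into the span of the moved vectors of \<open>J\<close> and the last
  \<open>n - card J - 1\<close> basis vectors. These are finitely many subspaces of dimension below
  \<open>n\<close>.\<close>

lemma generic_perturbation:
  fixes v :: "'i \<Rightarrow> 'b::euclidean_space" and e :: "nat \<Rightarrow> 'b"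
  assumes "finite F" "subspace W" "dim W = n" "\<And>i. i \<in> F \<Longrightarrow> v i \<in> W" "\<delta> > 0"
    and e: "inj_on e {..<n}" "pairwise orthogonal (e ` {..<n})" "\<And>l. l < n \<Longrightarrow> norm (e l) = 1"
      "span (e ` {..<n}) = W"
  shows "\<exists>v'. (\<forall>i\<in>F. v' i \<in> W \<and> norm (v' i - v i) < \<delta>) \<and> generic (\<lambda>i l. v' i \<bullet> e l) n F"
  using assms(1,4)
proof (induction F rule: finite_induct)
  case empty
  then show ?case by (simp add: generic_def)
next
  case (insert i F)
  then obtain v' where v': "\<And>i. i \<in> F \<Longrightarrow> v' i \<in> W \<and> norm (v' i - v i) < \<delta>"
    and gen: "generic (\<lambda>i l. v' i \<bullet> e l) n F" by blast
  define \<S> where "\<S> = (\<lambda>J. span (v' ` J \<union> e ` {Suc (card J)..<n})) ` {J. J \<subseteq> F \<and> card J < n}"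
  have finS: "finite \<S>" unfolding \<S>_def using insert.hyps(1) by simp
  have proper: "subspace S \<and> \<not> W \<subseteq> S" if "S \<in> \<S>" for S
  proof -
    from that obtain J where J: "J \<subseteq> F" "card J < n" "S = span (v' ` J \<union> e ` {Suc (card J)..<n})"
      by (auto simp: \<S>_def)
    have finJ: "finite J" using J insert.hyps finite_subset by blast
    have "dim S \<le> card (v' ` J \<union> e ` {Suc (card J)..<n})"
      unfolding J(3) dim_span by (rule dim_le_card') (use finJ in simp)
    also have "\<dots> \<le> card (v' ` J) + card (e ` {Suc (card J)..<n})" by (rule card_Un_le)
    also have "\<dots> \<le> card J + card {Suc (card J)..<n}"
      by (intro add_mono card_image_le) (use finJ in auto)
    also have "\<dots> < n" using J by simp
    finally have "dim S < dim W" using assms by simp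
    then show ?thesis using dim_subset[of W S] J(3) by auto
  qed
  obtain d where d: "d \<in> W" "\<forall>S\<in>\<S>. d \<notin> S"
    using avoid_subspaces[OF finS assms(2) proper] by blast
  have "\<exists>w\<in>W. norm (w - v i) < \<delta> \<and> (\<forall>S\<in>\<S>. w \<notin> S)"
    by (rule avoid_subspaces_near[where d = d]) (use finS proper d assms insert.prems in auto)
  then obtain w where w: "w \<in> W" "norm (w - v i) < \<delta>" "\<And>S. S \<in> \<S> \<Longrightarrow> w \<notin> S" by blast
  define v'' where "v'' = v'(i := w)"
  have v''W: "v'' j \<in> W" if "j \<in> insert i F" for j using that v' w by (auto simp: v''_def)
  have same: "v'' j = v' j" if "j \<in> F" for j using that insert.hyps by (auto simp: v''_def)
  have "generic (\<lambda>i l. v'' i \<bullet> e l) n (insert i F)"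
    unfolding generic_def
  proof (intro allI impI, elim conjE)
    fix J t
    assume J: "J \<subseteq> insert i F" "card J \<le> n" and k: "kernel_on (\<lambda>i l. v'' i \<bullet> e l) (card J) J t"
    have finJ: "finite J" using J insert.hyps by (meson finite.insertI finite_subset)
    have old: "\<forall>j\<in>J'. t j = 0"
      if "J' \<subseteq> F" "card J' \<le> n" "kernel_on (\<lambda>i l. v'' i \<bullet> e l) (card J') J' t" for J'
    proof -
      have "(\<Sum>j\<in>J'. t j * (v'' j \<bullet> e l)) = (\<Sum>j\<in>J'. t j * (v' j \<bullet> e l))" for l
        by (rule sum.cong) (use that same in auto)
      then have "kernel_on (\<lambda>i l. v' i \<bullet> e l) (card J') J' t"
        using that(3) by (simp add: kernel_on_def)
      then show ?thesis using gen that by (simp add: generic_def)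
    qed
    show "\<forall>j\<in>J. t j = 0"
    proof (cases "i \<in> J")
      case False
      then show ?thesis using old[of J] J k by blast
    next
      case True
      define J0 where "J0 = J - {i}"
      have J0: "J0 \<subseteq> F" "card J = Suc (card J0)" "finite J0" "J = insert i J0" "i \<notin> J0"
        using J(1) finJ True card_Suc_Diff1[OF finJ True] unfolding J0_def by (blast, simp_all add: insert_absorb)
      have "t i = 0"
      proof (rule ccontr)
        assume "t i \<noteq> 0"
        define u where "u = (\<Sum>j\<in>J. t j *\<^sub>R v'' j)"
        have orth: "u \<bullet> e l = 0" if "l < card J" for l
          using k that unfolding kernel_on_def u_def sum_mult_inner_eq by blast
        have uW: "u \<in> W" unfolding u_def
          by (intro subspace_sum subspace_scale assms(2) v''W) (use J in auto)
        have "u = (\<Sum>b\<in>e ` {..<n}. (u \<bullet> b) *\<^sub>R b)"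
          by (rule orthonormal_basis_expand[symmetric]) (use e uW in auto)
        also have "\<dots> = (\<Sum>l<n. (u \<bullet> e l) *\<^sub>R e l)" by (subst sum.reindex[OF e(1)]) simp
        also have "\<dots> = (\<Sum>l\<in>{card J..<n}. (u \<bullet> e l) *\<^sub>R e l)"
          by (rule sum.mono_neutral_right) (use orth in auto)
        finally have u: "u = (\<Sum>l\<in>{card J..<n}. (u \<bullet> e l) *\<^sub>R e l)" .
        define S where "S = span (v' ` J0 \<union> e ` {Suc (card J0)..<n})"
        have "(\<Sum>l\<in>{card J..<n}. (u \<bullet> e l) *\<^sub>R e l) \<in> S"
          unfolding S_def J0(2) by (intro span_sum span_scale span_base) simp
        then have "u \<in> S" by (simp only: u[symmetric])
        moreover have "v'' j \<in> v' ` J0" if "j \<in> J0" for j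
          using same[of j] J0(1) that by auto
        then have "(\<Sum>j\<in>J0. t j *\<^sub>R v'' j) \<in> S"
          unfolding S_def by (intro span_sum span_scale span_base) simp
        moreover have "u = t i *\<^sub>R w + (\<Sum>j\<in>J0. t j *\<^sub>R v'' j)"
          unfolding u_def J0(4) using J0 by (simp add: v''_def)
        ultimately have "t i *\<^sub>R w \<in> S"
          unfolding S_def using span_diff by (metis add_diff_cancel_right')
        then have "(1 / t i) *\<^sub>R t i *\<^sub>R w \<in> S" unfolding S_def by (rule span_scale)
        then have "w \<in> S" using \<open>t i \<noteq> 0\<close> by simp
        moreover have "S \<in> \<S>" using J0 J by (auto simp: \<S>_def S_def)
        ultimately show False using w(3) by blast
      qed
      then have "kernel_on (\<lambda>i l. v'' i \<bullet> e l) (card J0) J0 t"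
        using k J0 by (auto simp: kernel_on_def)
      then show ?thesis using old[of J0] J0 J \<open>t i = 0\<close> by auto
    qed
  qed
  moreover have "v'' j \<in> W \<and> norm (v'' j - v j) < \<delta>" if "j \<in> insert i F" for j
    using that v' w by (auto simp: v''_def)
  ultimately show ?case by blast
qed

section \<open>Stability of positive independence\<close>

definition positively_independent :: "'i set \<Rightarrow> ('i \<Rightarrow> 'b::real_vector) \<Rightarrow> bool" where
  "positively_independent I u \<longleftrightarrow>
     (\<forall>t. (\<forall>i\<in>I. 0 \<le> t i) \<and> (\<Sum>i\<in>I. t i *\<^sub>R u i) = 0 \<longrightarrow> (\<forall>i\<in>I. t i = 0))"

lemma positively_independent_cong:
  assumes "\<And>i. i \<in> I \<Longrightarrow> u i = u' i"
  shows "positively_independent I u \<longleftrightarrow> positively_independent I u'"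
  using assms by (simp add: positively_independent_def)

text \<open>Coefficients are indexed by \<open>I\<close> and not by points, because \<open>u\<close>
  need not be injective.\<close>

lemma convex_hull_image_sum:
  assumes "finite I" "x \<in> convex hull (u ` I)"
  shows "\<exists>t. (\<forall>i\<in>I. 0 \<le> t i) \<and> sum t I = 1 \<and> x = (\<Sum>i\<in>I. t i *\<^sub>R u i)"
proof -
  let ?C = "{x. \<exists>t. (\<forall>i\<in>I. 0 \<le> t i) \<and> sum t I = (1::real) \<and> x = (\<Sum>i\<in>I. t i *\<^sub>R u i)}"
  have "convex hull (u ` I) \<subseteq> ?C"
  proof (rule hull_minimal)
    show "u ` I \<subseteq> ?C"
    proof
      fix y assume "y \<in> u ` I"
      then obtain j where j: "j \<in> I" "y = u j" by blast
      have "(\<Sum>i\<in>I. (if i = j then 1 else 0) *\<^sub>R u i) = u j"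
        using j assms(1) by (simp add: if_distrib[of "\<lambda>c. c *\<^sub>R _"] sum.delta cong: if_cong)
      then show "y \<in> ?C" using j assms(1)
        by (intro CollectI exI[of _ "\<lambda>i. if i = j then 1 else 0"]) simp
    qed
    show "convex ?C"
    proof (rule convexI, safe)
      fix a b :: real and t s :: "'a \<Rightarrow> real"
      assume *: "0 \<le> a" "0 \<le> b" "a + b = 1" "\<forall>i\<in>I. 0 \<le> t i" "sum t I = 1" "\<forall>i\<in>I. 0 \<le> s i" "sum s I = 1"
      show "\<exists>r. (\<forall>i\<in>I. 0 \<le> r i) \<and> sum r I = 1 \<and>
        a *\<^sub>R (\<Sum>i\<in>I. t i *\<^sub>R u i) + b *\<^sub>R (\<Sum>i\<in>I. s i *\<^sub>R u i) = (\<Sum>i\<in>I. r i *\<^sub>R u i)"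
        using * by (intro exI[of _ "\<lambda>i. a * t i + b * s i"])
          (simp add: sum.distrib scaleR_sum_right sum_distrib_left[symmetric] scaleR_add_left)
    qed
  qed
  then show ?thesis using assms(2) by blast
qed

text \<open>The hull of the vectors is compact and misses 0. With \<open>\<delta>\<close> at most
  its distance from 0, every normalised combination moves by less than \<open>\<delta>\<close> and
  cannot reach 0.\<close>

lemma positively_independent_stable:
  fixes u :: "'i \<Rightarrow> 'b::euclidean_space"
  assumes "finite I" "positively_independent I u"
  shows "\<exists>\<delta>>0. \<forall>u'. (\<forall>i\<in>I. norm (u' i - u i) < \<delta>) \<longrightarrow> positively_independent I u'"
proof -
  let ?H = "convex hull (u ` I)"
  have "0 \<notin> ?H"
  proof
    assume "0 \<in> ?H"
    then obtain t where "\<forall>i\<in>I. 0 \<le> t i" "sum t I = 1" "0 = (\<Sum>i\<in>I. t i *\<^sub>R u i)"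
      using convex_hull_image_sum[OF assms(1)] by blast
    then show False using assms(2) unfolding positively_independent_def by (metis sum.neutral zero_neq_one)
  qed
  moreover have "closed ?H" using assms(1) by (simp add: compact_imp_closed finite_imp_compact_convex_hull)
  ultimately obtain \<delta> where \<delta>: "\<delta> > 0" "\<forall>y\<in>?H. \<delta> \<le> dist 0 y"
    using separate_point_closed by blast
  show ?thesis
  proof (intro exI[of _ \<delta>] conjI allI impI \<delta>(1))
    fix u' assume u': "\<forall>i\<in>I. norm (u' i - u i) < \<delta>"
    show "positively_independent I u'"
      unfolding positively_independent_def
    proof (intro allI impI, elim conjE)
      fix t assume t: "\<forall>i\<in>I. 0 \<le> t i" "(\<Sum>i\<in>I. t i *\<^sub>R u' i) = 0"
      show "\<forall>i\<in>I. t i = 0"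
      proof (rule ccontr)
        assume "\<not> (\<forall>i\<in>I. t i = 0)"
        then obtain j where j: "j \<in> I" "t j \<noteq> 0" by blast
        define T where "T = sum t I"
        have "T > 0" unfolding T_def using t(1) j assms(1) by (intro sum_pos2[of I j]) (auto simp: order_less_le)
        have "(\<Sum>i\<in>I. (t i / T) *\<^sub>R u i) \<in> ?H"
          by (rule convex_sum) (use assms(1) t(1) \<open>T > 0\<close> in \<open>auto simp: T_def sum_divide_distrib[symmetric] hull_inc\<close>)
        then have "\<delta> \<le> norm (\<Sum>i\<in>I. (t i / T) *\<^sub>R u i)" using \<delta>(2) by force
        also have "(\<Sum>i\<in>I. (t i / T) *\<^sub>R u i) = (1 / T) *\<^sub>R (\<Sum>i\<in>I. t i *\<^sub>R u i)"
          by (simp add: scaleR_sum_right)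
        also have "norm \<dots> = norm (\<Sum>i\<in>I. t i *\<^sub>R (u' i - u i)) / T"
          using t(2) \<open>T > 0\<close> by (simp add: scaleR_diff_right sum_subtractf)
        also have "\<dots> < \<delta>"
        proof -
          have "norm (\<Sum>i\<in>I. t i *\<^sub>R (u' i - u i)) \<le> (\<Sum>i\<in>I. t i * norm (u' i - u i))"
            by (rule order_trans[OF norm_sum]) (use t(1) in \<open>auto intro!: sum_mono\<close>)
          also have "\<dots> < (\<Sum>i\<in>I. t i * \<delta>)"
            by (rule sum_strict_mono_ex1) (use assms(1) t(1) u' j in \<open>auto intro!: mult_left_mono bexI[of _ j] simp: order_less_le\<close>)
          also have "\<dots> = \<delta> * T" by (simp add: T_def mult.commute sum_distrib_left)
          finally show ?thesis using \<open>T > 0\<close> by (simp add: pos_divide_less_eq)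
        qed
        finally show False by simp
      qed
    qed
  qed
qed

subsection \<open>Equivariant chain maps\<close>

fun faces :: "cube \<Rightarrow> cube set" where
  "faces [] = {}"
| "faces (a # Q) = (if odd a then {(a - 1) # Q, (a + 1) # Q} else {}) \<union> (#) a ` faces Q"

lemma bd_cong:
  assumes "\<And>R. R \<in> faces Q \<Longrightarrow> f R = g R"
  shows "bd f Q = bd g Q"
  using assms
proof (induction Q arbitrary: f g)
  case (Cons a Q)
  have "bd (\<lambda>R. f (a # R)) Q = bd (\<lambda>R. g (a # R)) Q"
    by (rule Cons.IH, rule Cons.prems) simp
  moreover have "odd a \<Longrightarrow> f ((a - 1) # Q) = g ((a - 1) # Q) \<and> f ((a + 1) # Q) = g ((a + 1) # Q)"
    using Cons.prems by simp
  ultimately show ?case by (cases "odd a") simp_all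
qed simp

lemma bd_uminus: "bd (\<lambda>R. f (map uminus R)) Q = bd f (map uminus Q)"
proof (induction Q arbitrary: f)
  case (Cons a Q)
  have eqs: "- (a - 1) = - a + 1" "- (a + 1) = - a - 1" "even (- a) \<longleftrightarrow> even a" by simp_all
  show ?case
    by (simp only: list.map bd.simps eqs Cons[of "\<lambda>R. f (- a # R)"]) (simp only: ac_simps)
qed simp

lemma bd_scale: "bd (\<lambda>R. c * f R) Q = c * bd f Q"
  by (induction Q arbitrary: f) (auto simp: algebra_simps)

lemma bd_sum: "bd (\<lambda>R. \<Sum>x\<in>X. f x R) Q = (\<Sum>x\<in>X. bd (f x) Q)"
  by (induction X rule: infinite_finite_induct) (simp_all add: bd_add)

lemma faces_dim:
  assumes "R \<in> faces Q"
  shows "length (filter odd Q) = Suc (length (filter odd R))"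
  using assms by (induction Q arbitrary: R) (auto split: if_splits)

lemma faces_entry:
  assumes "R \<in> faces Q"
  shows "length R = length Q"
    and "(\<forall>a\<in>set Q. \<bar>a\<bar> \<le> 2 * int N) \<Longrightarrow> (\<forall>a\<in>set R. \<bar>a\<bar> \<le> 2 * int N)"
    and "even b \<Longrightarrow> b \<in> set Q \<Longrightarrow> b \<in> set R"
proof -
  show "length R = length Q"
    using assms by (induction Q arbitrary: R) (auto split: if_splits)
  have odd_bound: "\<bar>a - 1\<bar> \<le> 2 * int N \<and> \<bar>a + 1\<bar> \<le> 2 * int N" if "\<bar>a\<bar> \<le> 2 * int N" "odd a" for a
    using that by presburger
  show "(\<forall>a\<in>set Q. \<bar>a\<bar> \<le> 2 * int N) \<Longrightarrow> (\<forall>a\<in>set R. \<bar>a\<bar> \<le> 2 * int N)"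
    using assms by (induction Q arbitrary: R) (use odd_bound in \<open>auto split: if_splits\<close>)
  show "even b \<Longrightarrow> b \<in> set Q \<Longrightarrow> b \<in> set R"
    using assms by (induction Q arbitrary: R) (auto split: if_splits)
qed

lemma faces_cells:
  assumes "Q \<in> cells N n j" "R \<in> faces Q"
  shows "\<exists>i. j = Suc i \<and> R \<in> cells N n i"
proof -
  obtain a where a: "a \<in> set Q" "\<bar>a\<bar> = 2 * int N" using assms by (auto simp: cells_def)
  \<comment> \<open>Even entries are never changed on passing to a face, so faces of cells of the
    sphere stay on the sphere.\<close>
  have "even a" using a(2) by presburger
  then have "a \<in> set R" using faces_entry(3)[OF assms(2)] a by blast
  then show ?thesis
    using assms(1) faces_dim[OF assms(2)] faces_entry(1)[OF assms(2)] faces_entry(2)[OF assms(2), of N] a(2)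
    by (auto simp: cells_def)
qed

lemma cells_uminus: "map uminus Q \<in> cells N n j \<longleftrightarrow> Q \<in> cells N n j"
proof -
  have "length (filter odd (map uminus Q)) = length (filter odd Q)"
    by (induction Q) auto
  then show ?thesis by (auto simp: cells_def)
qed

lemma simplicial_bd_superset:
  assumes "finite F" "A \<subseteq> F" "\<And>I. z I \<noteq> 0 \<Longrightarrow> I \<subseteq> A"
  shows "simplicial_bd F z J = simplicial_bd A z J"
  unfolding simplicial_bd_def
proof (rule sum.mono_neutral_right)
  show "\<forall>x\<in>F - J - (A - J). z (insert x J) = 0"
  proof
    fix x assume "x \<in> F - J - (A - J)"
    then have "\<not> insert x J \<subseteq> A" by auto
    then show "z (insert x J) = 0" using assms(3) by blast
  qed
qed (use assms in auto)

text \<open>For \<open>j = 0\<close> and \<open>z\<close> the indicator of the empty set, the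
  boundary condition says that \<open>w\<close> has an odd number of points: the augmentation
  condition imposed on the chain of a vertex.\<close>

definition is_filling :: "'i set \<Rightarrow> ('i set \<Rightarrow> nat) \<Rightarrow> nat \<Rightarrow> 'i set \<Rightarrow> ('i set \<Rightarrow> bit) \<Rightarrow> ('i set \<Rightarrow> bit) \<Rightarrow> bool" where
  "is_filling F \<mu> j A z w \<longleftrightarrow> (\<forall>I. w I \<noteq> 0 \<longrightarrow> I \<subseteq> A \<and> card I = Suc j \<and> \<mu> I = Suc j) \<and>
     (\<forall>J. simplicial_bd F w J = z J)"

text \<open>The chain of a cell only depends on its carrier and on the boundary data, and these agree
  for antipodal cells; choosing by Hilbert's operator thus makes the chain map equivariant.\<close>

primrec cell_chain :: "'i set \<Rightarrow> ('i set \<Rightarrow> nat) \<Rightarrow> (cube \<Rightarrow> 'i set) \<Rightarrow> nat \<Rightarrow> cube \<Rightarrow> 'i set \<Rightarrow> bit" where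
  "cell_chain F \<mu> A 0 = (\<lambda>Q. SOME w. is_filling F \<mu> 0 (A Q) (\<lambda>J. of_bool (J = {})) w)"
| "cell_chain F \<mu> A (Suc j) =
     (\<lambda>Q. SOME w. is_filling F \<mu> (Suc j) (A Q) (\<lambda>J. bd (\<lambda>R. cell_chain F \<mu> A j R J) Q) w)"

lemma cell_chain_uminus:
  assumes "\<And>Q. A (map uminus Q) = A Q"
  shows "cell_chain F \<mu> A j (map uminus Q) = cell_chain F \<mu> A j Q"
proof (induction j arbitrary: Q)
  case (Suc j)
  have "bd (\<lambda>R. cell_chain F \<mu> A j R J) (map uminus Q) = bd (\<lambda>R. cell_chain F \<mu> A j R J) Q" for J
    by (subst bd_uminus[symmetric]) (simp add: Suc)
  then show ?case by (simp add: assms)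
qed (simp add: assms)

lemma is_filling_exists:
  assumes "matroid_rank F \<mu>" "A \<subseteq> F" "j < \<mu> A"
    and "\<And>I. z I \<noteq> 0 \<Longrightarrow> I \<subseteq> A \<and> card I = j \<and> \<mu> I = j"
    and "\<And>J. simplicial_bd F z J = 0"
  shows "\<exists>w. is_filling F \<mu> j A z w"
proof -
  have fin: "finite F" using matroid_rankD(1)[OF assms(1)] .
  have "\<exists>w. (\<forall>I. w I \<noteq> 0 \<longrightarrow> I \<subseteq> A \<and> card I = Suc j \<and> \<mu> (I \<union> {}) = Suc j + card ({}::'a set)) \<and>
    (\<forall>J. simplicial_bd A w J = z J)"
  proof (rule fill_cycle[OF assms(1)])
    show "simplicial_bd A z J = 0" for J
      using assms(4,5) by (subst simplicial_bd_superset[OF fin assms(2), symmetric]) blast+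
  qed (use assms in auto)
  then obtain w where w: "\<And>I. w I \<noteq> 0 \<Longrightarrow> I \<subseteq> A \<and> card I = Suc j \<and> \<mu> I = Suc j"
    "\<And>J. simplicial_bd A w J = z J" by auto
  have "simplicial_bd F w J = z J" for J
    using w by (subst simplicial_bd_superset[OF fin assms(2)]) blast+
  then show ?thesis using w(1) unfolding is_filling_def by blast
qed

text \<open>The acyclic carrier argument. The chains on the facets of \<open>Q\<close> live on
  independent sets inside \<open>A Q\<close> because carriers grow from faces to cells; their sum is
  a cycle, and it bounds in \<open>A Q\<close> because the rank there exceeds
  \<open>n\<close>.\<close>

lemma cell_chain_filling:
  assumes M: "matroid_rank F \<mu>" and AF: "\<And>Q. A Q \<subseteq> F"
    and rank: "\<And>j Q. Q \<in> cells N n j \<Longrightarrow> j \<le> n \<Longrightarrow> n < \<mu> (A Q)"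
    and mono: "\<And>j Q R. Q \<in> cells N n j \<Longrightarrow> j \<le> n \<Longrightarrow> R \<in> faces Q \<Longrightarrow> A R \<subseteq> A Q"
    and Q: "Q \<in> cells N n j" "j \<le> n"
  shows "is_filling F \<mu> j (A Q)
    (case j of 0 \<Rightarrow> (\<lambda>J. of_bool (J = {})) | Suc i \<Rightarrow> (\<lambda>J. bd (\<lambda>R. cell_chain F \<mu> A i R J) Q))
    (cell_chain F \<mu> A j Q)"
  using Q
proof (induction j arbitrary: Q)
  case 0
  have "\<mu> {} = 0" using matroid_rankD(2)[OF M, of "{}"] by simp
  then have "\<exists>w. is_filling F \<mu> 0 (A Q) (\<lambda>J. of_bool (J = {})) w"
    by (intro is_filling_exists[OF M AF]) (use rank[OF 0] in \<open>auto simp: simplicial_bd_def\<close>)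
  then show ?case by (simp add: someI_ex)
next
  case (Suc j)
  have face: "R \<in> cells N n j" "A R \<subseteq> A Q" if "R \<in> faces Q" for R
    using faces_cells[OF Suc.prems(1) that] mono[OF Suc.prems that] by auto
  let ?z = "\<lambda>J. bd (\<lambda>R. cell_chain F \<mu> A j R J) Q"
  have IH: "is_filling F \<mu> j (A R)
    (case j of 0 \<Rightarrow> (\<lambda>J. of_bool (J = {})) | Suc i \<Rightarrow> (\<lambda>J. bd (\<lambda>R'. cell_chain F \<mu> A i R' J) R))
    (cell_chain F \<mu> A j R)" if "R \<in> faces Q" for R
    using Suc.IH[OF face(1)[OF that]] Suc.prems by simp
  have "\<exists>w. is_filling F \<mu> (Suc j) (A Q) ?z w"
  proof (rule is_filling_exists[OF M AF])
    show "Suc j < \<mu> (A Q)" using rank[OF Suc.prems] Suc.prems by simp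
    show "I \<subseteq> A Q \<and> card I = Suc j \<and> \<mu> I = Suc j" if "?z I \<noteq> 0" for I
    proof -
      have "\<exists>R\<in>faces Q. cell_chain F \<mu> A j R I \<noteq> 0"
      proof (rule ccontr)
        assume "\<not> ?thesis"
        then have "?z I = bd (\<lambda>R. 0) Q" by (intro bd_cong) blast
        then show False using that by simp
      qed
      then obtain R where R: "R \<in> faces Q" "cell_chain F \<mu> A j R I \<noteq> 0" by blast
      then have "I \<subseteq> A R \<and> card I = Suc j \<and> \<mu> I = Suc j"
        using IH[OF R(1)] unfolding is_filling_def by blast
      then show ?thesis using face(2)[OF R(1)] by blast
    qed
    show "simplicial_bd F ?z J = 0" for J
    proof -
      have "simplicial_bd F ?z J = bd (\<lambda>R. simplicial_bd F (cell_chain F \<mu> A j R) J) Q"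
        by (simp add: simplicial_bd_def bd_sum)
      also have "\<dots> = bd (\<lambda>R. case j of 0 \<Rightarrow> of_bool (J = {}) |
          Suc i \<Rightarrow> bd (\<lambda>R'. cell_chain F \<mu> A i R' J) R) Q"
        by (rule bd_cong) (use IH in \<open>auto simp: is_filling_def split: nat.splits\<close>)
      \<comment> \<open>For an edge, the augmentations of the two ends cancel; in higher dimension
        \<open>bd\<close> is applied twice.\<close>
      also have "\<dots> = 0" by (cases j) (simp_all add: bd_bd)
      finally show ?thesis .
    qed
  qed
  then show ?case by (simp add: someI_ex)
qed

text \<open>Adjointness of boundary and coboundary: both sides sum over pairs of a set
  \<open>I\<close> and an element \<open>x\<close>, the right one through
  \<open>J = I - {x}\<close>.\<close>

lemma sum_facets:
  assumes "finite F"
  shows "(\<Sum>I\<in>Pow F. z I * (\<Sum>x\<in>I. f (I - {x}))) = (\<Sum>J\<in>Pow F. simplicial_bd F z J * f J)"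
proof -
  have "(\<Sum>I\<in>Pow F. z I * (\<Sum>x\<in>I. f (I - {x}))) = (\<Sum>(I, x)\<in>(SIGMA I:Pow F. I). z I * f (I - {x}))"
    unfolding sum_distrib_left using assms
    by (subst sum.Sigma) (auto intro: finite_subset)
  also have "\<dots> = (\<Sum>(J, x)\<in>(SIGMA J:Pow F. F - J). z (insert x J) * f J)"
    by (rule sum.reindex_bij_witness[of _ "\<lambda>(J, x). (insert x J, x)" "\<lambda>(I, x). (I - {x}, x)"])
      (auto simp: insert_absorb)
  also have "\<dots> = (\<Sum>J\<in>Pow F. simplicial_bd F z J * f J)"
    unfolding simplicial_bd_def sum_distrib_right using assms
    by (subst sum.Sigma) auto
  finally show ?thesis .
qed

lemma crossing_cong:
  assumes "\<And>i. i \<in> I \<Longrightarrow> y i = y' i"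
  shows "crossing y I = crossing y' I"
proof -
  have "(\<Sum>i\<in>I. t i * y i l) = (\<Sum>i\<in>I. t i * y' i l)" for t l
    by (rule sum.cong) (use assms in auto)
  then show ?thesis by (simp add: crossing_def positive_kernel_on_def kernel_on_def)
qed

text \<open>The combinatorial form of the nonexistence of an odd map from an \<open>n\<close>-sphere into
  \<open>\<real>\<^sup>n - {0}\<close>: here \<open>\<sigma> Q i * y i l\<close> are the coordinates of the vertex \<open>i\<close> with the sign that
  it carries on the cell \<open>Q\<close>.\<close>

lemma no_signed_carrier:
  fixes y :: "'i \<Rightarrow> nat \<Rightarrow> real" and \<sigma> :: "cube \<Rightarrow> 'i \<Rightarrow> real"
  assumes M: "matroid_rank F \<mu>" and "0 < n" and AF: "\<And>Q. A Q \<subseteq> F"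
    and rank: "\<And>j Q. Q \<in> cells N n j \<Longrightarrow> j \<le> n \<Longrightarrow> n < \<mu> (A Q)"
    and mono: "\<And>j Q R. Q \<in> cells N n j \<Longrightarrow> j \<le> n \<Longrightarrow> R \<in> faces Q \<Longrightarrow> A R \<subseteq> A Q"
    and anti: "\<And>Q. A (map uminus Q) = A Q"
    and sgn: "\<And>Q i. \<sigma> Q i = 1 \<or> \<sigma> Q i = - 1"
    and sgn_anti: "\<And>j Q i. Q \<in> cells N n j \<Longrightarrow> j \<le> n \<Longrightarrow> i \<in> A Q \<Longrightarrow> \<sigma> (map uminus Q) i = - \<sigma> Q i"
    and sgn_face: "\<And>j Q R i. Q \<in> cells N n j \<Longrightarrow> j \<le> n \<Longrightarrow> R \<in> faces Q \<Longrightarrow> i \<in> A R \<Longrightarrow> \<sigma> R i = \<sigma> Q i"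
    and gen: "generic y n F"
    and sep: "\<And>Q I t. Q \<in> cells N n n \<Longrightarrow> I \<subseteq> A Q \<Longrightarrow> \<mu> I = card I \<Longrightarrow>
       \<not> positive_kernel_on (\<lambda>i l. \<sigma> Q i * y i l) n I t"
  shows False
proof -
  have fin: "finite F" using matroid_rankD(1)[OF M] .
  define C where "C j = cell_chain F \<mu> A j" for j
  define Y where "Y Q i l = \<sigma> Q i * y i l" for Q i l
  \<comment> \<open>The crossing number of the chain of \<open>Q\<close>. In dimension
    \<open>n\<close> no coordinate is left to define a crossing; the value 0 still satisfies the
    coboundary relation, since \<open>sep\<close> keeps the images of the top simplices off the
    origin.\<close>
  define \<beta> where "\<beta> Q = (let j = length (filter odd Q) in
     if j < n then \<Sum>I\<in>Pow F. C j Q I * crossing (Y Q) I else 0)" for Q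
  have fill: "is_filling F \<mu> j (A Q)
    (case j of 0 \<Rightarrow> (\<lambda>J. of_bool (J = {})) | Suc i \<Rightarrow> (\<lambda>J. bd (\<lambda>R. C i R J) Q)) (C j Q)"
    if "Q \<in> cells N n j" "j \<le> n" for Q j
    unfolding C_def by (rule cell_chain_filling[OF M AF rank mono that])
  have supp: "I \<subseteq> A Q \<and> card I = Suc j \<and> \<mu> I = Suc j" if "Q \<in> cells N n j" "j \<le> n" "C j Q I \<noteq> 0" for Q j I
    using fill[OF that(1,2)] that(3) unfolding is_filling_def by blast
  have genY: "generic (Y Q) n I" if "I \<subseteq> F" for Q I
  proof -
    have "generic (Y Q) n F"
      unfolding generic_def
    proof (intro allI impI, elim conjE)
      fix J t assume J: "J \<subseteq> F" "card J \<le> n" "kernel_on (Y Q) (card J) J t"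
      have "kernel_on y (card J) J (\<lambda>i. t i * \<sigma> Q i)"
        using J(3) by (simp add: kernel_on_def Y_def mult.assoc)
      then have "\<forall>i\<in>J. t i * \<sigma> Q i = 0" using gen J unfolding generic_def by blast
      then show "\<forall>i\<in>J. t i = 0" using sgn[of Q] by (metis mult_eq_0_iff neg_equal_0_iff_equal zero_neq_one)
    qed
    then show ?thesis using generic_mono that by blast
  qed
  \<comment> \<open>This and \<open>bd_eq\<close> evaluate the two sides of the relation required by
    \<open>cubical_tucker\<close> to the same count: simplices in the chain of \<open>Q\<close> that
    meet the flag subspace whose codimension is the dimension of \<open>Q\<close>.\<close>
  have sum_antipodal: "\<beta> Q + \<beta> (map uminus Q) =
      (\<Sum>I\<in>Pow F. C j Q I * of_bool (\<exists>t. positive_kernel_on (Y Q) j I t))"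
    if Q: "Q \<in> cells N n j" "j < n" for Q j
  proof -
    have dims: "length (filter odd Q) = j" "length (filter odd (map uminus Q)) = j"
      using Q(1) cells_uminus[of Q N n j] by (auto simp: cells_def simp del: filter_map)
    have "\<beta> Q + \<beta> (map uminus Q) =
      (\<Sum>I\<in>Pow F. C j Q I * (crossing (Y Q) I + crossing (Y (map uminus Q)) I))"
      unfolding \<beta>_def Let_def dims using Q(2)
      by (simp add: C_def cell_chain_uminus[of A, OF anti] sum.distrib distrib_left)
    also have "\<dots> = (\<Sum>I\<in>Pow F. C j Q I * of_bool (\<exists>t. positive_kernel_on (Y Q) j I t))"
    proof (rule sum.cong[OF refl])
      fix I assume "I \<in> Pow F"
      show "C j Q I * (crossing (Y Q) I + crossing (Y (map uminus Q)) I) =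
        C j Q I * of_bool (\<exists>t. positive_kernel_on (Y Q) j I t)"
      proof (cases "C j Q I = 0")
        case False
        then have I: "I \<subseteq> A Q" "card I = Suc j" using supp Q by auto
        have "crossing (Y (map uminus Q)) I = crossing (\<lambda>i l. - Y Q i l) I"
          by (rule crossing_cong) (use I sgn_anti[OF Q(1)] Q(2) in \<open>auto simp: Y_def fun_eq_iff\<close>)
        moreover have "finite I" using I(2) card.infinite by fastforce
        ultimately show ?thesis
          using crossing_antipodal[OF genY _ I(2) Q(2)] \<open>I \<in> Pow F\<close> by simp
      qed simp
    qed
    finally show ?thesis .
  qed
  have bd_eq: "bd \<beta> Q = (\<Sum>I\<in>Pow F. C (Suc j) Q I * of_bool (\<exists>t. positive_kernel_on (Y Q) (Suc j) I t))"
    if Q: "Q \<in> cells N n (Suc j)" "Suc j \<le> n" for Q j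
  proof -
    have "(\<Sum>I\<in>Pow F. C (Suc j) Q I * of_bool (\<exists>t. positive_kernel_on (Y Q) (Suc j) I t)) =
      (\<Sum>I\<in>Pow F. C (Suc j) Q I * (\<Sum>x\<in>I. crossing (Y Q) (I - {x})))"
    proof (rule sum.cong[OF refl])
      fix I assume "I \<in> Pow F"
      show "C (Suc j) Q I * of_bool (\<exists>t. positive_kernel_on (Y Q) (Suc j) I t) =
        C (Suc j) Q I * (\<Sum>x\<in>I. crossing (Y Q) (I - {x}))"
      proof (cases "C (Suc j) Q I = 0")
        case False
        then have I: "card I = Suc (Suc j)" using supp Q by auto
        have "finite I" using \<open>I \<in> Pow F\<close> fin finite_subset by blast
        then show ?thesis using crossing_facets[OF genY _ I, of Q] \<open>I \<in> Pow F\<close> Q(2) by simp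
      qed simp
    qed
    also have "\<dots> = (\<Sum>J\<in>Pow F. simplicial_bd F (C (Suc j) Q) J * crossing (Y Q) J)"
      by (rule sum_facets[OF fin])
    also have "\<dots> = (\<Sum>J\<in>Pow F. crossing (Y Q) J * bd (\<lambda>R. C j R J) Q)"
      using fill[OF Q] by (simp add: is_filling_def mult.commute)
    also have "\<dots> = bd (\<lambda>R. \<Sum>J\<in>Pow F. crossing (Y Q) J * C j R J) Q"
      by (simp add: bd_sum bd_scale)
    also have "\<dots> = bd \<beta> Q"
    proof (rule bd_cong)
      fix R assume R: "R \<in> faces Q"
      have Rc: "R \<in> cells N n j" using faces_cells[OF Q(1) R] by auto
      then have dim: "length (filter odd R) = j" by (simp add: cells_def)
      have eq: "crossing (Y Q) J * C j R J = C j R J * crossing (Y R) J" for J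
      proof (cases "C j R J = 0")
        case False
        then have J: "J \<subseteq> A R" using supp[OF Rc] Q(2) by auto
        have "crossing (Y Q) J = crossing (Y R) J"
          by (rule crossing_cong) (use J sgn_face[OF Q R] in \<open>auto simp: Y_def fun_eq_iff\<close>)
        then show ?thesis by simp
      qed simp
      show "(\<Sum>J\<in>Pow F. crossing (Y Q) J * C j R J) = \<beta> R"
        unfolding eq using Q(2) dim by (simp add: \<beta>_def)
    qed
    finally show ?thesis by simp
  qed
  show False
  proof (rule cubical_tucker[of N n \<beta>])
    fix Q assume Q: "Q \<in> cells N n 0"
    \<comment> \<open>With no equations every nonempty set has a positive solution, so the count is
      the number of points in the vertex chain, odd by augmentation.\<close>
    have "positive_kernel_on (Y Q) 0 I (\<lambda>_. 1)" if "C 0 Q I \<noteq> 0" for I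
    proof -
      have "card I = 1" using supp[OF Q _ that] by simp
      then have "I \<noteq> {}" by auto
      then show ?thesis by (auto simp: positive_kernel_on_def kernel_on_def)
    qed
    then have "\<beta> Q + \<beta> (map uminus Q) = (\<Sum>I\<in>Pow F. C 0 Q I)"
      unfolding sum_antipodal[OF Q \<open>0 < n\<close>]
      by (intro sum.cong[OF refl]) (metis (full_types) of_bool_eq(2) mult.right_neutral mult_zero_left)
    also have "\<dots> = (\<Sum>I\<in>(\<lambda>x. {x}) ` F. C 0 Q I)"
    proof (rule sum.mono_neutral_right)
      show "\<forall>I\<in>Pow F - (\<lambda>x. {x}) ` F. C 0 Q I = 0"
      proof (rule ballI, rule ccontr)
        fix I assume I: "I \<in> Pow F - (\<lambda>x. {x}) ` F" "C 0 Q I \<noteq> 0"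
        have "card I = 1" using supp[OF Q _ I(2)] by simp
        then show False using I(1) by (auto simp: card_1_singleton_iff)
      qed
    qed (use fin in auto)
    also have "\<dots> = simplicial_bd F (C 0 Q) {}"
      by (simp add: simplicial_bd_def sum.reindex)
    also have "\<dots> = 1" using fill[OF Q] by (simp add: is_filling_def)
    finally show "\<beta> Q + \<beta> (map uminus Q) = 1" .
  next
    fix j Q assume Q: "Q \<in> cells N n (Suc j)" "Suc j \<le> n"
    show "bd \<beta> Q = \<beta> Q + \<beta> (map uminus Q)"
    proof (cases "Suc j = n")
      case False
      then show ?thesis using bd_eq[OF Q] sum_antipodal[OF Q(1)] Q(2) by simp
    next
      case True
      have zero: "C n Q I * of_bool (\<exists>t. positive_kernel_on (Y Q) n I t) = 0" for I
      proof (cases "C n Q I = 0")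
        case False
        then have "I \<subseteq> A Q" "\<mu> I = card I" using supp[of Q n I] Q True by auto
        then show ?thesis using sep[of Q I] Q True by (auto simp: Y_def[abs_def])
      qed simp
      have "bd \<beta> Q = 0" unfolding bd_eq[OF Q] True zero by simp
      moreover have "length (filter odd Q) = n" "length (filter odd (map uminus Q)) = n"
        using Q True cells_uminus[of Q N n n] by (auto simp: cells_def simp del: filter_map)
      then have "\<beta> Q = 0" "\<beta> (map uminus Q) = 0" unfolding \<beta>_def Let_def by simp_all
      ultimately show ?thesis by simp
    qed
  next
    fix Q assume Q: "Q \<in> cells N n n"
    then have "length (filter odd Q) = n" "length (filter odd (map uminus Q)) = n"
      using cells_uminus[of Q N n n] by (auto simp: cells_def simp del: filter_map)
    then show "\<beta> Q + \<beta> (map uminus Q) = 0" unfolding \<beta>_def Let_def by simp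
  qed
qed

subsection \<open>Directions with a low rank set of one-sided members\<close>

text \<open>The centre of a cell for grid unit \<open>s\<close> and axes \<open>E k\<close>,
  \<open>E (Suc k)\<close>, and so on; an odd entry is already the midpoint of its interval.\<close>

primrec cube_point :: "(nat \<Rightarrow> 'c::real_vector) \<Rightarrow> real \<Rightarrow> nat \<Rightarrow> cube \<Rightarrow> 'c" where
  "cube_point E s k [] = 0"
| "cube_point E s k (a # Q) = (s * of_int a) *\<^sub>R E k + cube_point E s (Suc k) Q"

lemma cube_point_uminus: "cube_point E s k (map uminus Q) = - cube_point E s k Q"
  by (induction Q arbitrary: k) auto

lemma norm_cube_point_face:
  fixes E :: "nat \<Rightarrow> 'c::real_normed_vector"
  assumes "R \<in> faces Q" "k + length Q \<le> m" "\<And>l. l < m \<Longrightarrow> norm (E l) = 1" "0 \<le> s"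
  shows "norm (cube_point E s k Q - cube_point E s k R) \<le> s"
  using assms(1,2)
proof (induction Q arbitrary: k R)
  case (Cons a Q)
  have Ek: "norm (E k) = 1" using Cons.prems assms(3) by simp
  show ?case
  proof (cases "R \<in> (#) a ` faces Q")
    case True
    then obtain R' where R': "R' \<in> faces Q" "R = a # R'" by blast
    show ?thesis using Cons.IH[OF R'(1), of "Suc k"] Cons.prems R' by simp
  next
    case False
    then have "R = (a - 1) # Q \<or> R = (a + 1) # Q" using Cons.prems by (auto split: if_splits)
    then obtain c :: real where c: "\<bar>c\<bar> = 1"
      "cube_point E s k (a # Q) - cube_point E s k R = (s * c) *\<^sub>R E k"
    proof
      assume R: "R = (a - 1) # Q"
      show thesis by (rule that[of 1]) (simp_all add: R algebra_simps)
    next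
      assume R: "R = (a + 1) # Q"
      show thesis by (rule that[of "-1"]) (simp_all add: R algebra_simps)
    qed
    then show ?thesis using Ek assms(4) by (simp add: abs_mult)
  qed
qed simp

lemma norm_cube_point_le:
  fixes E :: "nat \<Rightarrow> 'c::real_normed_vector"
  assumes "\<forall>a\<in>set Q. s * \<bar>of_int a\<bar> \<le> 1" "k + length Q \<le> m" "\<And>l. l < m \<Longrightarrow> norm (E l) = 1" "0 \<le> s"
  shows "norm (cube_point E s k Q) \<le> real (length Q)"
  using assms(1,2)
proof (induction Q arbitrary: k)
  case (Cons a Q)
  have "norm (E k) = 1" using Cons.prems assms(3) by simp
  then have "norm ((s * of_int a) *\<^sub>R E k) \<le> 1" using Cons.prems assms(4) by (simp add: abs_mult)
  moreover have "norm (cube_point E s (Suc k) Q) \<le> real (length Q)" using Cons by simp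
  ultimately show ?case
    using norm_triangle_ineq[of "(s * of_int a) *\<^sub>R E k" "cube_point E s (Suc k) Q"] by simp
qed simp

lemma norm_cube_point_ge:
  fixes E :: "nat \<Rightarrow> 'c::real_inner"
  assumes E: "\<And>l l'. l < m \<Longrightarrow> l' < m \<Longrightarrow> E l \<bullet> E l' = (if l = l' then 1 else 0)"
    and "a \<in> set Q" "k + length Q \<le> m" "0 \<le> s"
  shows "s * \<bar>of_int a\<bar> \<le> norm (cube_point E s k Q)"
proof (cases "s * of_int a = 0")
  case nz: False
  have below: "cube_point E s k Q \<bullet> E l = 0" if "l < k" "k + length Q \<le> m" for l k Q
    using that by (induction Q arbitrary: k) (auto simp: inner_add_left E)
  have "\<exists>l<m. cube_point E s k Q \<bullet> E l = s * of_int a"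
    using assms(2,3)
  proof (induction Q arbitrary: k)
    case (Cons b Q)
    show ?case
    proof (cases "a = b")
      case True
      then show ?thesis using Cons.prems below[of k "Suc k" Q]
        by (intro exI[of _ k]) (simp add: inner_add_left E)
    next
      case False
      obtain l where l: "l < m" "cube_point E s (Suc k) Q \<bullet> E l = s * of_int a"
        using Cons.IH[of "Suc k"] Cons.prems False by auto
      moreover have "l \<noteq> k" using l below[of k "Suc k" Q] Cons.prems nz by auto
      ultimately show ?thesis using Cons.prems by (auto simp: inner_add_left E)
    qed
  qed simp
  then obtain l where l: "l < m" "cube_point E s k Q \<bullet> E l = s * of_int a" by blast
  have "norm (E l) = 1" using E[OF l(1) l(1)] by (simp add: norm_eq_sqrt_inner)
  then show ?thesis
    using Cauchy_Schwarz_ineq2[of "cube_point E s k Q" "E l"] l(2) assms(4) by (simp add: abs_mult)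
qed (use assms(4) in \<open>auto simp: mult_nonneg_nonneg\<close>)

section \<open>Uniform margins of one-sided members\<close>

definition one_sided :: "('i \<Rightarrow> 'c::real_inner set) \<Rightarrow> 'i set \<Rightarrow> 'c \<Rightarrow> 'i set" where
  "one_sided P F z = {i\<in>F. (\<forall>q\<in>P i. 0 < z \<bullet> q) \<or> (\<forall>q\<in>P i. z \<bullet> q < 0)}"

definition margin_set :: "('i \<Rightarrow> 'c::real_inner set) \<Rightarrow> 'i set \<Rightarrow> real \<Rightarrow> 'c \<Rightarrow> 'i set" where
  "margin_set P F \<epsilon> z = {i\<in>F. (\<forall>q\<in>P i. \<epsilon> < z \<bullet> q) \<or> (\<forall>q\<in>P i. z \<bullet> q < - \<epsilon>)}"

lemma finite_positive_lower_bound: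
  assumes "finite S" "\<And>x. x \<in> S \<Longrightarrow> (0::real) < x"
  shows "\<exists>\<epsilon>>0. \<forall>x\<in>S. \<epsilon> < x"
  using assms
proof (induction S rule: finite_induct)
  case (insert x S)
  then obtain \<epsilon> where "\<epsilon> > 0" "\<forall>x\<in>S. \<epsilon> < x" by auto
  then show ?case using insert.prems[of x] by (intro exI[of _ "min \<epsilon> (x / 2)"]) auto
qed (auto intro: exI[of _ 1])

text \<open>Finiteness of the sets \<open>P i\<close> gives a positive margin at each single
  \<open>z\<close>. The sets \<open>U \<epsilon>\<close> are open, grow as \<open>\<epsilon>\<close>
  shrinks and cover \<open>Z\<close>, so by compactness one of them contains
  \<open>Z\<close>.\<close>

lemma uniform_margin:
  fixes P :: "'i \<Rightarrow> 'c::euclidean_space set"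
  assumes M: "matroid_rank F \<mu>" and P: "\<And>i. i \<in> F \<Longrightarrow> finite (P i)"
    and "compact Z" and rank: "\<And>z. z \<in> Z \<Longrightarrow> n < \<mu> (one_sided P F z)"
  shows "\<exists>\<epsilon>>0. \<forall>z\<in>Z. n < \<mu> (margin_set P F \<epsilon> z)"
proof -
  have fin: "finite F" using matroid_rankD(1)[OF M] .
  define U where "U \<epsilon> = {z. n < \<mu> (margin_set P F \<epsilon> z)}" for \<epsilon>
  have openU: "open (U \<epsilon>)" for \<epsilon>
  proof -
    have "U \<epsilon> = (\<Union>B\<in>{B. B \<subseteq> F \<and> n < \<mu> B}. \<Inter>i\<in>B.
        (\<Inter>q\<in>P i. {z. \<epsilon> < z \<bullet> q}) \<union> (\<Inter>q\<in>P i. {z. z \<bullet> q < - \<epsilon>}))" (is "_ = ?R")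
    proof (intro equalityI subsetI)
      fix z assume "z \<in> U \<epsilon>"
      then show "z \<in> ?R" unfolding U_def
        by (intro UN_I[of "margin_set P F \<epsilon> z"]) (auto simp: margin_set_def)
    next
      fix z assume "z \<in> ?R"
      then obtain B where B: "B \<subseteq> F" "n < \<mu> B" "B \<subseteq> margin_set P F \<epsilon> z"
        by (auto simp: margin_set_def subset_iff)
      have "\<mu> B \<le> \<mu> (margin_set P F \<epsilon> z)"
        by (rule matroid_rankD(3)[OF M B(3)]) (auto simp: margin_set_def)
      then show "z \<in> U \<epsilon>" using B(2) by (simp add: U_def)
    qed
    also have "open \<dots>"
      using fin P
      by (intro open_UN open_INT open_Un ballI open_Collect_less continuous_intros)
        (auto intro: finite_subset)
    finally show ?thesis .
  qed
  have mono: "U \<epsilon>' \<subseteq> U \<epsilon>" if "\<epsilon> \<le> \<epsilon>'" for \<epsilon> \<epsilon>'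
  proof
    fix z assume "z \<in> U \<epsilon>'"
    have "margin_set P F \<epsilon>' z \<subseteq> margin_set P F \<epsilon> z" "margin_set P F \<epsilon> z \<subseteq> F"
      using that by (fastforce simp: margin_set_def)+
    from matroid_rankD(3)[OF M this] \<open>z \<in> U \<epsilon>'\<close> show "z \<in> U \<epsilon>" by (simp add: U_def)
  qed
  have cover: "Z \<subseteq> (\<Union>\<epsilon>\<in>{0<..}. U \<epsilon>)"
  proof
    fix z assume z: "z \<in> Z"
    let ?B = "one_sided P F z"
    have "?B \<subseteq> F" by (auto simp: one_sided_def)
    then have "finite ((\<lambda>q. \<bar>z \<bullet> q\<bar>) ` (\<Union>i\<in>?B. P i))"
      using fin P by (intro finite_imageI finite_UN_I) (auto intro: finite_subset)
    moreover have "0 < x" if "x \<in> (\<lambda>q. \<bar>z \<bullet> q\<bar>) ` (\<Union>i\<in>?B. P i)" for x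
      using that by (fastforce simp: one_sided_def)
    ultimately obtain \<epsilon> where \<epsilon>: "\<epsilon> > 0" "\<And>i q. i \<in> ?B \<Longrightarrow> q \<in> P i \<Longrightarrow> \<epsilon> < \<bar>z \<bullet> q\<bar>"
      using finite_positive_lower_bound by (metis (no_types, lifting) UN_I image_eqI)
    have "?B \<subseteq> margin_set P F \<epsilon> z"
    proof
      fix i assume i: "i \<in> ?B"
      have "\<epsilon> < z \<bullet> q" if "0 < z \<bullet> q" "q \<in> P i" for q using \<epsilon>(2)[OF i that(2)] that(1) by linarith
      moreover have "z \<bullet> q < - \<epsilon>" if "z \<bullet> q < 0" "q \<in> P i" for q using \<epsilon>(2)[OF i that(2)] that(1) by linarith
      ultimately show "i \<in> margin_set P F \<epsilon> z" using i by (auto simp: one_sided_def margin_set_def)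
    qed
    then have "\<mu> ?B \<le> \<mu> (margin_set P F \<epsilon> z)"
      by (rule matroid_rankD(3)[OF M]) (auto simp: margin_set_def)
    then have "z \<in> U \<epsilon>" using rank[OF z] by (simp add: U_def)
    then show "z \<in> (\<Union>\<epsilon>\<in>{0<..}. U \<epsilon>)" using \<epsilon>(1) by blast
  qed
  obtain C where C: "C \<subseteq> {0<..}" "finite C" "Z \<subseteq> (\<Union>\<epsilon>\<in>C. U \<epsilon>)"
    using compactE_image[OF \<open>compact Z\<close> _ cover] openU by metis
  show ?thesis
  proof (cases "C = {}")
    case True
    then show ?thesis using C(3) by (intro exI[of _ 1]) auto
  next
    case False
    have "Min C > 0" using C False by (auto simp: subset_iff)
    moreover have "Z \<subseteq> U (Min C)"
      using C(3) mono Min_le[OF C(2)] by blast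
    ultimately show ?thesis by (auto simp: U_def)
  qed
qed

text \<open>The value -1 is also the default where the member is not one-sided, and an empty
  \<open>P i\<close> gets 1; the sign is meaningful only for one-sided members with nonempty
  \<open>P i\<close>.\<close>

definition side :: "('i \<Rightarrow> 'c::real_inner set) \<Rightarrow> 'c \<Rightarrow> 'i \<Rightarrow> real" where
  "side P z i = (if \<forall>q\<in>P i. 0 < z \<bullet> q then 1 else - 1)"

text \<open>A 0-chain filling the empty simplex has nonempty support, and its points are
  independent.\<close>

lemma exists_independent_singleton:
  assumes "matroid_rank F \<mu>" "A \<subseteq> F" "0 < \<mu> A"
  shows "\<exists>i\<in>A. \<mu> {i} = 1"
proof -
  have "\<mu> {} = 0" using matroid_rankD(2)[OF assms(1), of "{}"] by simp
  then have "\<exists>w. is_filling F \<mu> 0 A (\<lambda>J. of_bool (J = {})) w"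
    by (intro is_filling_exists[OF assms]) (auto simp: simplicial_bd_def)
  then obtain w where "is_filling F \<mu> 0 A (\<lambda>J. of_bool (J = {})) w" by blast
  then have w: "\<forall>I. w I \<noteq> 0 \<longrightarrow> I \<subseteq> A \<and> card I = 1 \<and> \<mu> I = 1" and w_bd: "simplicial_bd F w {} = 1"
    by (simp_all add: is_filling_def)
  have "\<exists>x\<in>F. w {x} \<noteq> 0"
  proof (rule ccontr)
    assume "\<not> ?thesis"
    then have "simplicial_bd F w {} = 0" by (simp add: simplicial_bd_def)
    then show False using w_bd by simp
  qed
  then show ?thesis using w by blast
qed

text \<open>If all directions had rank above \<open>n\<close>, the cubical n-sphere on
  \<open>n + 1\<close> coordinate axes would carry the data excluded by
  \<open>no_signed_carrier\<close>, with carriers formed by the members that have enough margin at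
  the centre of a cell.\<close>

lemma exists_low_rank_direction:
  fixes P :: "'i \<Rightarrow> 'c::euclidean_space set" and v :: "'i \<Rightarrow> 'b::euclidean_space"
  assumes M: "matroid_rank F \<mu>" and P: "\<And>i. i \<in> F \<Longrightarrow> finite (P i) \<and> P i \<noteq> {}"
    and "n < DIM('c)" and W: "subspace W" "dim W = n" and v: "\<And>i. i \<in> F \<Longrightarrow> v i \<in> W"
    and sep: "\<And>z I. I \<subseteq> one_sided P F z \<Longrightarrow> \<mu> I = card I \<Longrightarrow>
       positively_independent I (\<lambda>i. side P z i *\<^sub>R v i)"
  shows "\<exists>z. z \<noteq> 0 \<and> \<mu> (one_sided P F z) \<le> n"
proof (rule ccontr)
  assume contra: "\<not> ?thesis"
  have rank: "n < \<mu> (one_sided P F z)" if "z \<noteq> 0" for z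
    using that contra by (meson not_le)
  have fin: "finite F" using matroid_rankD(1)[OF M] .
  obtain h where h: "bij_betw h {..<DIM('c)} (Basis :: 'c set)"
    using ex_bij_betw_nat_finite[OF finite_Basis] by (metis lessThan_atLeast0)
  have E: "h l \<bullet> h l' = (if l = l' then 1 else 0)" if "l < Suc n" "l' < Suc n" for l l'
  proof -
    have "l \<in> {..<DIM('c)}" "l' \<in> {..<DIM('c)}" using that \<open>n < DIM('c)\<close> by auto
    then have "h l \<in> Basis" "h l' \<in> Basis" "h l = h l' \<longleftrightarrow> l = l'"
      using h by (auto dest: bij_betwE simp: inj_on_eq_iff[OF bij_betw_imp_inj_on[OF h]])
    then show ?thesis by (simp add: inner_Basis)
  qed
  have nE: "norm (h l) = 1" if "l < Suc n" for l
    using E[OF that that] by (simp add: norm_eq_sqrt_inner)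
  have "n > 0"
  proof (rule ccontr)
    assume "\<not> n > 0"
    then have "W \<subseteq> {0}" using W by (metis dim_eq_0 gr0I)
    moreover have "h 0 \<noteq> 0" using nE[of 0] by auto
    then obtain i where i: "i \<in> one_sided P F (h 0)" "\<mu> {i} = 1"
      using exists_independent_singleton[OF M, of "one_sided P F (h 0)"] rank[of "h 0"]
      by (auto simp: one_sided_def)
    moreover have "i \<in> F" using i by (simp add: one_sided_def)
    ultimately have "v i = 0" using v by blast
    then show False using sep[of "{i}" "h 0"] i
      by (auto simp: positively_independent_def dest: spec[of _ "\<lambda>_. 1"])
  qed
  \<comment> \<open>This shell contains all centres: one coordinate has modulus 1, and each of the
    \<open>n + 1\<close> coordinates has modulus at most 1.\<close>
  have cpt: "compact (cball 0 (real (Suc n)) - ball (0::'c) 1)" by (simp add: compact_diff)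
  have "\<exists>\<epsilon>>0. \<forall>z\<in>cball 0 (real (Suc n)) - ball 0 1. n < \<mu> (margin_set P F \<epsilon> z)"
    by (rule uniform_margin[OF M _ cpt], use P in simp, rule rank) auto
  then obtain \<epsilon> where \<epsilon>: "\<epsilon> > 0"
    "\<And>z. norm z \<le> real (Suc n) \<Longrightarrow> 1 \<le> norm z \<Longrightarrow> n < \<mu> (margin_set P F \<epsilon> z)" by auto
  have "finite (\<Union>i\<in>F. P i)" using fin P by blast
  then obtain L where L: "L > 0" "\<And>i q. i \<in> F \<Longrightarrow> q \<in> P i \<Longrightarrow> norm q \<le> L"
    using finite_imp_bounded bounded_pos by (metis UN_I)
  \<comment> \<open>Climbing from a vertex to an n-cell takes \<open>n\<close> steps of cost
    \<open>\<eta>\<close>, so less than \<open>\<epsilon>\<close> is lost in total.\<close>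
  define \<eta> where "\<eta> = \<epsilon> / (2 * real (Suc n))"
  have "\<eta> > 0" using \<epsilon>(1) by (simp add: \<eta>_def)
  \<comment> \<open>The centres of a cell and of its facet are at distance at most \<open>s\<close>,
    so an inner product with a point of norm at most \<open>L\<close> changes by at most
    \<open>s * L\<close>; the mesh is chosen to keep this below the cost of one step.\<close>
  obtain N :: nat where N: "L / \<eta> < real N" using reals_Archimedean2 by blast
  have "N > 0" using N L(1) \<open>\<eta> > 0\<close> by (metis divide_pos_pos gr0I less_asym of_nat_0)
  define s where "s = 1 / (2 * real N)"
  have s: "0 < s" "s * L \<le> \<eta>"
  proof -
    show "0 < s" using \<open>N > 0\<close> by (simp add: s_def)
    have "L < \<eta> * real N" using N \<open>\<eta> > 0\<close> by (simp add: pos_divide_less_eq mult.commute)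
    also have "\<dots> \<le> \<eta> * (2 * real N)" using \<open>\<eta> > 0\<close> by (intro mult_left_mono) auto
    finally have "L \<le> \<eta> * (2 * real N)" by simp
    then show "s * L \<le> \<eta>" using \<open>N > 0\<close> by (simp add: s_def pos_divide_le_eq)
  qed
  define pt where "pt Q = cube_point h s 0 Q" for Q
  \<comment> \<open>The margin shrinks with each dimension by at least what the move from a facet to its cell costs,
    so the members with this margin at a face keep it, with the same sign, on the whole cell.\<close>
  define lev where "lev Q = \<epsilon> - \<eta> * real (length (filter odd Q))" for Q :: cube
  define A where "A Q = margin_set P F (lev Q) (pt Q)" for Q
  have pt_uminus: "pt (map uminus Q) = - pt Q" for Q by (simp add: pt_def cube_point_uminus)
  have lev_uminus: "lev (map uminus Q) = lev Q" for Q
  proof -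
    have "length (filter odd (map uminus Q)) = length (filter odd Q)" by (induction Q) auto
    then show ?thesis by (simp add: lev_def)
  qed
  have lev_pos: "lev Q > 0" if "Q \<in> cells N n j" "j \<le> n" for Q j
  proof -
    have "\<eta> * real j < \<eta> * (2 * real (Suc n))"
      using that(2) \<open>\<eta> > 0\<close> by (intro mult_strict_left_mono) auto
    also have "\<dots> = \<epsilon>" by (simp add: \<eta>_def)
    finally show ?thesis using that(1) by (simp add: lev_def cells_def)
  qed
  have len: "length Q = Suc n" if "Q \<in> cells N n j" for Q j using that by (simp add: cells_def)
  have norm_pt: "norm (pt Q) \<le> real (Suc n)" "1 \<le> norm (pt Q)" if Q: "Q \<in> cells N n j" for Q j
  proof -
    have "s * \<bar>of_int a\<bar> \<le> 1" if "a \<in> set Q" for a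
    proof -
      have "\<bar>a\<bar> \<le> 2 * int N" using Q that by (simp add: cells_def)
      then have "real_of_int \<bar>a\<bar> \<le> real_of_int (2 * int N)" by (simp only: of_int_le_iff)
      then show ?thesis using \<open>N > 0\<close> by (simp add: s_def)
    qed
    then have "norm (pt Q) \<le> real (length Q)"
      unfolding pt_def by (intro norm_cube_point_le[of Q s 0 "Suc n"]) (use nE s len[OF Q] in auto)
    then show "norm (pt Q) \<le> real (Suc n)" using len[OF Q] by simp
    obtain a where a: "a \<in> set Q" "\<bar>a\<bar> = 2 * int N" using Q by (auto simp: cells_def)
    have "s * \<bar>of_int a\<bar> \<le> norm (pt Q)"
      unfolding pt_def by (rule norm_cube_point_ge[of "Suc n"]) (use E a s len[OF Q] in auto)
    moreover have "real_of_int \<bar>a\<bar> = 2 * real N" using a(2) by simp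
    ultimately show "1 \<le> norm (pt Q)" using \<open>N > 0\<close> by (simp add: s_def)
  qed
  have face: "lev R = lev Q + \<eta> \<and> (\<forall>i\<in>F. \<forall>q\<in>P i. \<bar>pt Q \<bullet> q - pt R \<bullet> q\<bar> \<le> \<eta>)"
    if "Q \<in> cells N n j" "R \<in> faces Q" for Q R j
  proof (intro conjI ballI)
    show "lev R = lev Q + \<eta>" using faces_dim[OF that(2)] by (simp add: lev_def algebra_simps)
    fix i q assume iq: "i \<in> F" "q \<in> P i"
    have "norm (pt Q - pt R) \<le> s"
      unfolding pt_def by (rule norm_cube_point_face[of _ _ _ "Suc n"]) (use that nE s len in auto)
    then have "norm (pt Q - pt R) * norm q \<le> s * L"
      using L(2)[OF iq] s(1) by (intro mult_mono) auto
    moreover have "\<bar>(pt Q - pt R) \<bullet> q\<bar> \<le> norm (pt Q - pt R) * norm q" by (rule Cauchy_Schwarz_ineq2)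
    ultimately show "\<bar>pt Q \<bullet> q - pt R \<bullet> q\<bar> \<le> \<eta>" using s(2) by (simp add: inner_diff_left)
  qed
  have sided: "i \<in> F \<and> ((side P (pt Q) i = 1 \<and> (\<forall>q\<in>P i. lev Q < pt Q \<bullet> q)) \<or>
      (side P (pt Q) i = - 1 \<and> (\<forall>q\<in>P i. pt Q \<bullet> q < - lev Q)))"
    if Q: "Q \<in> cells N n j" "j \<le> n" and i: "i \<in> A Q" for Q j i
  proof -
    have iF: "i \<in> F" using i by (simp add: A_def margin_set_def)
    obtain q0 where q0: "q0 \<in> P i" using P[OF iF] by blast
    from i consider "\<forall>q\<in>P i. lev Q < pt Q \<bullet> q" | "\<forall>q\<in>P i. pt Q \<bullet> q < - lev Q"
      by (auto simp: A_def margin_set_def)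
    then show ?thesis
    proof cases
      case 1
      then have "\<forall>q\<in>P i. 0 < pt Q \<bullet> q" using lev_pos[OF Q] by force
      then show ?thesis using 1 iF by (simp add: side_def)
    next
      case 2
      then have "pt Q \<bullet> q0 < 0" using lev_pos[OF Q] q0 by force
      then have "side P (pt Q) i = - 1" using q0 by (force simp: side_def)
      then show ?thesis using 2 iF by simp
    qed
  qed
  have A_one_sided: "A Q \<subseteq> one_sided P F (pt Q)" if "Q \<in> cells N n j" "j \<le> n" for Q j
    using lev_pos[OF that] unfolding A_def margin_set_def one_sided_def by force
  have face_sided: "i \<in> A Q \<and> side P (pt R) i = side P (pt Q) i"
    if Q: "Q \<in> cells N n j" "j \<le> n" and R: "R \<in> faces Q" and i: "i \<in> A R" for Q R j i
  proof -
    obtain j' where j': "j = Suc j'" "R \<in> cells N n j'" using faces_cells[OF Q(1) R] by blast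
    have sR: "i \<in> F" "(side P (pt R) i = 1 \<and> (\<forall>q\<in>P i. lev R < pt R \<bullet> q)) \<or>
      (side P (pt R) i = - 1 \<and> (\<forall>q\<in>P i. pt R \<bullet> q < - lev R))"
      using sided[OF j'(2) _ i] Q(2) j'(1) by auto
    have lev: "lev R = lev Q + \<eta>" and close: "\<And>q. q \<in> P i \<Longrightarrow> \<bar>pt Q \<bullet> q - pt R \<bullet> q\<bar> \<le> \<eta>"
      using face[OF Q(1) R] sR(1) by auto
    obtain q0 where q0: "q0 \<in> P i" using P[OF sR(1)] by blast
    from sR(2) show ?thesis
    proof (elim disjE conjE)
      assume *: "side P (pt R) i = 1" "\<forall>q\<in>P i. lev R < pt R \<bullet> q"
      have "\<forall>q\<in>P i. lev Q < pt Q \<bullet> q"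
      proof
        fix q assume "q \<in> P i"
        then show "lev Q < pt Q \<bullet> q" using close[of q] *(2) lev by force
      qed
      then have "i \<in> A Q" using sR(1) by (simp add: A_def margin_set_def)
      moreover have "\<forall>q\<in>P i. 0 < pt Q \<bullet> q" using \<open>\<forall>q\<in>P i. lev Q < pt Q \<bullet> q\<close> lev_pos[OF Q] by force
      ultimately show ?thesis using *(1) by (simp add: side_def)
    next
      assume *: "side P (pt R) i = - 1" "\<forall>q\<in>P i. pt R \<bullet> q < - lev R"
      have neg: "\<forall>q\<in>P i. pt Q \<bullet> q < - lev Q"
      proof
        fix q assume "q \<in> P i"
        then show "pt Q \<bullet> q < - lev Q" using close[of q] *(2) lev by force
      qed
      then have "i \<in> A Q" using sR(1) by (simp add: A_def margin_set_def)
      moreover have "pt Q \<bullet> q0 < 0" using neg q0 lev_pos[OF Q] by force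
      then have "side P (pt Q) i = - 1" using q0 by (force simp: side_def)
      ultimately show ?thesis using *(1) by simp
    qed
  qed
  \<comment> \<open>One perturbation must serve all cells. A cell enters only through a set
    \<open>I\<close> and the subset \<open>J\<close> of its members of sign 1, and there are
    finitely many such pairs.\<close>
  have "\<exists>\<delta>>0. \<forall>v'. (\<forall>i\<in>F. norm (v' i - v i) < \<delta>) \<longrightarrow>
      (\<forall>X\<in>{(I, J). I \<subseteq> F \<and> J \<subseteq> I \<and> positively_independent I (\<lambda>i. (if i \<in> J then 1 else - 1) *\<^sub>R v i)}.
        positively_independent (fst X) (\<lambda>i. (if i \<in> snd X then 1 else - 1) *\<^sub>R v' i))"
    (is "\<exists>\<delta>>0. \<forall>v'. _ \<longrightarrow> (\<forall>X\<in>?\<X>. ?indep X v')")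
  proof -
    have "?\<X> \<subseteq> Pow F \<times> Pow F" by auto
    then have fin\<X>: "finite ?\<X>" using fin by (meson finite_Pow_iff finite_SigmaI finite_subset)
    have "\<forall>X\<in>?\<X>. \<exists>\<delta>>0. \<forall>v'. (\<forall>i\<in>F. norm (v' i - v i) < \<delta>) \<longrightarrow> ?indep X v'"
    proof
      fix X assume "X \<in> ?\<X>"
      then obtain I J where X: "X = (I, J)" "I \<subseteq> F"
        "positively_independent I (\<lambda>i. (if i \<in> J then 1 else - 1) *\<^sub>R v i)" by auto
      have "finite I" using X(2) fin finite_subset by blast
      from positively_independent_stable[OF this X(3)] obtain \<delta> where \<delta>: "\<delta> > 0"
        "\<And>u'. (\<forall>i\<in>I. norm (u' i - (if i \<in> J then 1 else - 1) *\<^sub>R v i) < \<delta>) \<Longrightarrow> positively_independent I u'"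
        by blast
      have "?indep X v'" if "\<forall>i\<in>F. norm (v' i - v i) < \<delta>" for v'
        unfolding X(1) fst_conv snd_conv
      proof (rule \<delta>(2), rule ballI)
        fix i assume "i \<in> I"
        then have "norm (v' i - v i) < \<delta>" using that X(2) by blast
        then show "norm ((if i \<in> J then 1 else - 1) *\<^sub>R v' i - (if i \<in> J then 1 else - 1) *\<^sub>R v i) < \<delta>"
          by (auto simp: norm_minus_commute)
      qed
      then show "\<exists>\<delta>>0. \<forall>v'. (\<forall>i\<in>F. norm (v' i - v i) < \<delta>) \<longrightarrow> ?indep X v'" using \<delta>(1) by blast
    qed
    from bchoice[OF this] obtain d where d: "\<forall>X\<in>?\<X>. d X > 0 \<and>
        (\<forall>v'. (\<forall>i\<in>F. norm (v' i - v i) < d X) \<longrightarrow> ?indep X v')" ..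
    obtain \<delta> where \<delta>: "\<delta> > 0" "\<forall>x\<in>d ` ?\<X>. \<delta> < x"
      using finite_positive_lower_bound[of "d ` ?\<X>"] fin\<X> d by blast
    show ?thesis
    proof (intro exI[of _ \<delta>] conjI allI impI ballI \<delta>(1))
      fix v' X assume v': "\<forall>i\<in>F. norm (v' i - v i) < \<delta>" and X: "X \<in> ?\<X>"
      have "\<delta> < d X" using \<delta>(2) X by blast
      then have "\<forall>i\<in>F. norm (v' i - v i) < d X" using v' by force
      then show "?indep X v'" using bspec[OF d X] by blast
    qed
  qed
  then obtain \<delta> where \<delta>: "\<delta> > 0" "\<And>v' I J. \<lbrakk>\<forall>i\<in>F. norm (v' i - v i) < \<delta>; I \<subseteq> F; J \<subseteq> I;
      positively_independent I (\<lambda>i. (if i \<in> J then 1 else - 1) *\<^sub>R v i)\<rbrakk> \<Longrightarrow>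
      positively_independent I (\<lambda>i. (if i \<in> J then 1 else - 1) *\<^sub>R v' i)"
    by fastforce
  obtain B where B: "B \<subseteq> W" "pairwise orthogonal B" "\<And>x. x \<in> B \<Longrightarrow> norm x = 1"
    "independent B" "card B = dim W" "span B = W"
    using orthonormal_basis_subspace[OF W(1)] by blast
  have "finite B" using B(4) by (rule independent_imp_finite)
  then obtain e where e: "bij_betw e {..<n} B"
    using ex_bij_betw_nat_finite[of B] B(5) W(2) by (metis lessThan_atLeast0)
  have e_img: "e ` {..<n} = B" "inj_on e {..<n}" using e by (auto simp: bij_betw_def)
  have "\<exists>v'. (\<forall>i\<in>F. v' i \<in> W \<and> norm (v' i - v i) < \<delta>) \<and> generic (\<lambda>i l. v' i \<bullet> e l) n F"
    by (rule generic_perturbation[OF fin W v \<delta>(1)]) (use e_img B in auto)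
  then obtain v' where v': "\<And>i. i \<in> F \<Longrightarrow> v' i \<in> W" "\<forall>i\<in>F. norm (v' i - v i) < \<delta>"
    "generic (\<lambda>i l. v' i \<bullet> e l) n F" by blast
  show False
  proof (rule no_signed_carrier[OF M \<open>n > 0\<close>, where A = A and \<sigma> = "\<lambda>Q. side P (pt Q)" and N = N
      and y = "\<lambda>i l. v' i \<bullet> e l"])
    show "A Q \<subseteq> F" for Q by (auto simp: A_def margin_set_def)
    show "n < \<mu> (A Q)" if "Q \<in> cells N n j" "j \<le> n" for j Q
    proof -
      have "lev Q \<le> \<epsilon>" using \<open>\<eta> > 0\<close> by (simp add: lev_def)
      then have "margin_set P F \<epsilon> (pt Q) \<subseteq> A Q" "A Q \<subseteq> F"
        unfolding A_def margin_set_def by force+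
      from matroid_rankD(3)[OF M this] show ?thesis
        using \<epsilon>(2)[OF norm_pt[OF that(1)]] by simp
    qed
    show "A R \<subseteq> A Q" if "Q \<in> cells N n j" "j \<le> n" "R \<in> faces Q" for j Q R
      using face_sided[OF that] by blast
    show "A (map uminus Q) = A Q" for Q
      by (auto simp: A_def margin_set_def pt_uminus lev_uminus)
    show "side P (pt Q) i = 1 \<or> side P (pt Q) i = - 1" for Q i by (simp add: side_def)
    show "side P (pt (map uminus Q)) i = - side P (pt Q) i"
      if Q: "Q \<in> cells N n j" "j \<le> n" "i \<in> A Q" for j Q i
    proof -
      obtain q0 where q0: "q0 \<in> P i" using sided[OF Q] P by blast
      from sided[OF Q] lev_pos[OF Q(1,2)] q0 show ?thesis
        unfolding side_def pt_uminus by force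
    qed
    show "side P (pt R) i = side P (pt Q) i"
      if "Q \<in> cells N n j" "j \<le> n" "R \<in> faces Q" "i \<in> A R" for j Q R i
      using face_sided[OF that] by simp
    show "generic (\<lambda>i l. v' i \<bullet> e l) n F" by (rule v'(3))
    show "\<not> positive_kernel_on (\<lambda>i l. side P (pt Q) i * (v' i \<bullet> e l)) n I t"
      if Q: "Q \<in> cells N n n" and I: "I \<subseteq> A Q" "\<mu> I = card I" for Q I t
    proof
      assume t: "positive_kernel_on (\<lambda>i l. side P (pt Q) i * (v' i \<bullet> e l)) n I t"
      have IF: "I \<subseteq> F" using I(1) by (auto simp: A_def margin_set_def)
      define J where "J = {i\<in>I. side P (pt Q) i = 1}"
      have side: "side P (pt Q) i = (if i \<in> J then 1 else - 1)" if "i \<in> I" for i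
        using that by (auto simp: J_def side_def)
      have "positively_independent I (\<lambda>i. side P (pt Q) i *\<^sub>R v i)"
        by (rule sep) (use I A_one_sided[OF Q] in auto)
      then have "positively_independent I (\<lambda>i. (if i \<in> J then 1 else - 1) *\<^sub>R v i)"
        by (subst positively_independent_cong[of I _ "\<lambda>i. side P (pt Q) i *\<^sub>R v i"]) (simp_all add: side)
      then have indep: "positively_independent I (\<lambda>i. (if i \<in> J then 1 else - 1) *\<^sub>R v' i)"
        by (intro \<delta>(2)[OF v'(2) IF]) (auto simp: J_def)
      define u where "u = (\<Sum>i\<in>I. t i *\<^sub>R (if i \<in> J then 1 else - 1) *\<^sub>R v' i)"
      have "u \<in> W" unfolding u_def
        by (intro subspace_sum subspace_scale W(1) v'(1)) (use IF in auto)
      moreover have "u \<bullet> b = 0" if b: "b \<in> B" for b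
      proof -
        obtain l where l: "l < n" "b = e l" using b e_img by auto
        have "u \<bullet> b = (\<Sum>i\<in>I. t i * (side P (pt Q) i * (v' i \<bullet> e l)))"
          unfolding u_def l(2) inner_sum_left by (rule sum.cong) (simp_all add: side)
        then show ?thesis using t l(1) by (simp add: positive_kernel_on_def kernel_on_def)
      qed
      ultimately have "u = 0"
        using orthonormal_basis_expand[OF B(2,3) _ \<open>finite B\<close>, of u] B(6) by simp
      then show False
        using indep t unfolding positively_independent_def positive_kernel_on_def u_def by blast
    qed
  qed
qed

subsection \<open>Hyperplane transversals\<close>

text \<open>By Caratheodory a common point of two hulls needs finitely many points of each
  subfamily, and there are finitely many pairs of subfamilies. It is used in contrapositive form:
  hulls that are disjoint after restriction to \<open>X\<close> were disjoint before.\<close>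

lemma finite_convex_hull_witnesses:
  fixes K :: "'i \<Rightarrow> 'a::euclidean_space set"
  assumes "finite F"
  shows "\<exists>X. finite X \<and> (\<forall>G1 G2. G1 \<subseteq> F \<and> G2 \<subseteq> F \<and> conv_family K G1 \<inter> conv_family K G2 \<noteq> {} \<longrightarrow>
    conv_family (\<lambda>i. X \<inter> K i) G1 \<inter> conv_family (\<lambda>i. X \<inter> K i) G2 \<noteq> {})"
proof -
  have fin_witness: "\<exists>S. finite S \<and> x \<in> conv_family (\<lambda>i. S \<inter> K i) G" if x: "x \<in> conv_family K G" for x G
  proof -
    obtain S where S: "finite S" "S \<subseteq> (\<Union>i\<in>G. K i)" "x \<in> convex hull S"
      using x unfolding conv_family_def caratheodory[of "\<Union>i\<in>G. K i"] by blast
    have "S \<subseteq> (\<Union>i\<in>G. S \<inter> K i)" using S(2) by blast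
    then have "x \<in> conv_family (\<lambda>i. S \<inter> K i) G"
      using S(3) hull_mono unfolding conv_family_def by blast
    then show ?thesis using S(1) by blast
  qed
  have mono: "conv_family (\<lambda>i. S \<inter> K i) G \<subseteq> conv_family (\<lambda>i. X \<inter> K i) G" if "S \<subseteq> X" for S X G
    unfolding conv_family_def by (rule hull_mono) (use that in blast)
  have "\<exists>S. finite S \<and> (conv_family K (fst p) \<inter> conv_family K (snd p) \<noteq> {} \<longrightarrow>
      conv_family (\<lambda>i. S \<inter> K i) (fst p) \<inter> conv_family (\<lambda>i. S \<inter> K i) (snd p) \<noteq> {})" for p
  proof (cases "conv_family K (fst p) \<inter> conv_family K (snd p) = {}")
    case False
    then obtain x where "x \<in> conv_family K (fst p)" "x \<in> conv_family K (snd p)" by blast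
    then obtain S T where "finite S" "x \<in> conv_family (\<lambda>i. S \<inter> K i) (fst p)"
      "finite T" "x \<in> conv_family (\<lambda>i. T \<inter> K i) (snd p)"
      using fin_witness by metis
    then have "finite (S \<union> T)" "x \<in> conv_family (\<lambda>i. (S \<union> T) \<inter> K i) (fst p)"
      "x \<in> conv_family (\<lambda>i. (S \<union> T) \<inter> K i) (snd p)"
      using mono[of S "S \<union> T"] mono[of T "S \<union> T"] by blast+
    then show ?thesis by blast
  qed auto
  then obtain S where S: "\<And>p. finite (S p)"
    "\<And>p. conv_family K (fst p) \<inter> conv_family K (snd p) \<noteq> {} \<Longrightarrow>
      conv_family (\<lambda>i. S p \<inter> K i) (fst p) \<inter> conv_family (\<lambda>i. S p \<inter> K i) (snd p) \<noteq> {}"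
    by metis
  define X where "X = (\<Union>p\<in>Pow F \<times> Pow F. S p)"
  have "finite X" unfolding X_def using assms S(1) by blast
  moreover have "conv_family (\<lambda>i. X \<inter> K i) G1 \<inter> conv_family (\<lambda>i. X \<inter> K i) G2 \<noteq> {}"
    if "G1 \<subseteq> F" "G2 \<subseteq> F" "conv_family K G1 \<inter> conv_family K G2 \<noteq> {}" for G1 G2
  proof -
    have "S (G1, G2) \<subseteq> X" using that by (auto simp: X_def)
    then show ?thesis using S(2)[of "(G1, G2)"] that(3) mono[of "S (G1, G2)" X] by fastforce
  qed
  ultimately show ?thesis by blast
qed

text \<open>A member that is not one-sided has points of \<open>X\<close> weakly on both sides of
  the hyperplane and meets it by connectedness. So it is enough to find a direction with one-sided
  members of rank at most \<open>k + 1\<close>.\<close>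

lemma transversal_nonempty_members:
  fixes K :: "'i \<Rightarrow> 'a::euclidean_space set" and V :: "'b::euclidean_space set"
  assumes M: "matroid_rank F \<mu>" and conv: "\<And>i. i \<in> F \<Longrightarrow> convex (K i)"
    and ne: "\<And>i. i \<in> F \<Longrightarrow> K i \<noteq> {}"
    and "k < DIM('a)" and V: "subspace V" "dim V = k" and \<phi>: "\<And>i. i \<in> F \<Longrightarrow> \<phi> i \<in> V"
    and sep: "\<And>G1 G2. \<lbrakk>G1 \<subseteq> F; G2 \<subseteq> F; \<mu> (G1 \<union> G2) = card G1 + card G2;
           conv_family K G1 \<inter> conv_family K G2 = {}\<rbrakk>
         \<Longrightarrow> convex hull (\<phi> ` G1) \<inter> convex hull (\<phi> ` G2) = {}"
  shows "\<exists>G. G \<subseteq> F \<and> \<mu> (F - G) \<le> k + 1 \<and> has_hyperplane_transversal K G"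
proof -
  have fin: "finite F" using matroid_rankD(1)[OF M] .
  from finite_convex_hull_witnesses[OF fin, of K] obtain X where finX: "finite X" and
    witness: "\<forall>G1 G2. G1 \<subseteq> F \<and> G2 \<subseteq> F \<and> conv_family K G1 \<inter> conv_family K G2 \<noteq> {} \<longrightarrow>
       conv_family (\<lambda>i. X \<inter> K i) G1 \<inter> conv_family (\<lambda>i. X \<inter> K i) G2 \<noteq> {}"
    by (elim exE conjE)
  \<comment> \<open>The pairing of \<open>(u, b)\<close> with \<open>(p, - 1)\<close> is
    \<open>u \<bullet> p - b\<close>, so sides of the hyperplane become signs of a linear
    form.\<close>
  define P where "P i = (\<lambda>p. (p, - 1 :: real)) ` (X \<inter> K i)" for i
  define v where "v i = (\<phi> i, 1 :: real)" for i
  \<comment> \<open>Taking both subfamilies to be \<open>{i}\<close> forces \<open>X\<close> to meet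
    every nonempty member.\<close>
  have XK: "X \<inter> K i \<noteq> {}" if "i \<in> F" for i
    using witness[rule_format, of "{i}" "{i}"] that ne[OF that] by (auto simp: conv_family_def)
  have side_cases: "(side P (u, b) i = 1 \<and> (\<forall>p\<in>X \<inter> K i. b < u \<bullet> p)) \<or>
      (side P (u, b) i = - 1 \<and> (\<forall>p\<in>X \<inter> K i. u \<bullet> p < b))"
    if "i \<in> one_sided P F (u, b)" for u b i
  proof -
    have "i \<in> F" using that by (simp add: one_sided_def)
    then obtain p where p: "p \<in> X \<inter> K i" using XK by blast
    from that consider "\<forall>p\<in>X \<inter> K i. b < u \<bullet> p" | "\<forall>p\<in>X \<inter> K i. u \<bullet> p < b"
      by (auto simp: one_sided_def P_def)
    then show ?thesis
    proof cases
      case 1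
      then show ?thesis by (simp add: side_def P_def)
    next
      case 2
      then have "\<not> b < u \<bullet> p" using p by (meson not_less_iff_gr_or_eq)
      then have "side P (u, b) i = - 1" using p by (auto simp: side_def P_def)
      then show ?thesis using 2 by blast
    qed
  qed
  have "\<exists>z. z \<noteq> 0 \<and> \<mu> (one_sided P F z) \<le> k + 1"
  proof (rule exists_low_rank_direction[OF M, where W = "V \<times> UNIV" and v = v])
    show "finite (P i) \<and> P i \<noteq> {}" if "i \<in> F" for i
      using XK[OF that] finX by (simp add: P_def)
    show "k + 1 < DIM('a \<times> real)" using \<open>k < DIM('a)\<close> by simp
    show "subspace (V \<times> (UNIV :: real set))" using V(1) by (intro subspace_Times) auto
    show "dim (V \<times> (UNIV :: real set)) = k + 1" using V by (simp add: dim_Times)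
    show "v i \<in> V \<times> UNIV" if "i \<in> F" for i using \<phi>[OF that] by (simp add: v_def)
    fix z :: "'a \<times> real" and I
    assume I: "I \<subseteq> one_sided P F z" "\<mu> I = card I"
    obtain u b where z: "z = (u, b)" by (cases z)
    have IF: "I \<subseteq> F" using I(1) by (auto simp: one_sided_def)
    then have finI: "finite I" using fin finite_subset by blast
    define I1 where "I1 = {i\<in>I. side P z i = 1}"
    define I2 where "I2 = I - I1"
    have split: "I1 \<union> I2 = I" "I1 \<inter> I2 = {}" "finite I1" "finite I2" "I1 \<subseteq> F" "I2 \<subseteq> F"
      using finI IF by (auto simp: I1_def I2_def)
    have pos: "b < u \<bullet> p" if "i \<in> I1" "p \<in> X \<inter> K i" for i p
      using side_cases[of i u b] that I(1) by (auto simp: I1_def z)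
    have side2: "side P z i = - 1" if "i \<in> I2" for i
    proof -
      have "side P z i \<noteq> 1" using that by (simp add: I1_def I2_def)
      then show ?thesis by (metis side_def)
    qed
    have neg: "u \<bullet> p < b" if "i \<in> I2" "p \<in> X \<inter> K i" for i p
      using side_cases[of i u b] that I(1) side2[OF that(1)] by (auto simp: I2_def z)
    have "conv_family (\<lambda>i. X \<inter> K i) I1 \<subseteq> {x. b < u \<bullet> x}"
      unfolding conv_family_def by (rule hull_minimal) (use pos convex_halfspace_gt in auto)
    moreover have "conv_family (\<lambda>i. X \<inter> K i) I2 \<subseteq> {x. u \<bullet> x < b}"
      unfolding conv_family_def by (rule hull_minimal) (use neg convex_halfspace_lt in auto)
    ultimately have "conv_family (\<lambda>i. X \<inter> K i) I1 \<inter> conv_family (\<lambda>i. X \<inter> K i) I2 = {}"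
      by force
    then have "conv_family K I1 \<inter> conv_family K I2 = {}"
      using witness[rule_format, of I1 I2] split(5,6) by metis
    moreover have "\<mu> (I1 \<union> I2) = card I1 + card I2"
      using I(2) split card_Un_disjoint by metis
    ultimately have disj: "convex hull (\<phi> ` I1) \<inter> convex hull (\<phi> ` I2) = {}"
      using sep split by blast
    show "positively_independent I (\<lambda>i. side P z i *\<^sub>R v i)"
      unfolding positively_independent_def
    proof (intro allI impI, elim conjE)
      fix t assume t: "\<forall>i\<in>I. 0 \<le> t i" "(\<Sum>i\<in>I. t i *\<^sub>R side P z i *\<^sub>R v i) = 0"
      have "(\<Sum>i\<in>I. t i *\<^sub>R side P z i *\<^sub>R v i) =
        (\<Sum>i\<in>I1. t i *\<^sub>R side P z i *\<^sub>R v i) + (\<Sum>i\<in>I2. t i *\<^sub>R side P z i *\<^sub>R v i)"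
        by (subst split(1)[symmetric], rule sum.union_disjoint) (use split in auto)
      also have "(\<Sum>i\<in>I1. t i *\<^sub>R side P z i *\<^sub>R v i) = (\<Sum>i\<in>I1. t i *\<^sub>R v i)"
        by (rule sum.cong) (auto simp: I1_def)
      also have "(\<Sum>i\<in>I2. t i *\<^sub>R side P z i *\<^sub>R v i) = - (\<Sum>i\<in>I2. t i *\<^sub>R v i)"
        by (simp add: side2 sum_negf)
      finally have eq: "(\<Sum>i\<in>I1. t i *\<^sub>R v i) = (\<Sum>i\<in>I2. t i *\<^sub>R v i)" using t(2) by simp
      have "(\<Sum>i\<in>J. t i *\<^sub>R v i) = (\<Sum>i\<in>J. t i *\<^sub>R \<phi> i, sum t J)" for J
        by (simp add: v_def sum_prod)
      then have eqs: "(\<Sum>i\<in>I1. t i *\<^sub>R \<phi> i) = (\<Sum>i\<in>I2. t i *\<^sub>R \<phi> i)" "sum t I1 = sum t I2"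
        using eq by simp_all
      have nn: "\<forall>i\<in>I1. 0 \<le> t i" "\<forall>i\<in>I2. 0 \<le> t i" using t(1) split by auto
      \<comment> \<open>The last coordinate gives both parts the same total weight; dividing by a
        positive weight would produce a common point of the two hulls.\<close>
      have "sum t I1 = 0"
      proof (rule ccontr)
        assume "sum t I1 \<noteq> 0"
        then have T: "sum t I1 > 0" using nn(1) by (simp add: order_less_le sum_nonneg)
        have mem: "(\<Sum>i\<in>J. (t i / sum t J) *\<^sub>R \<phi> i) \<in> convex hull (\<phi> ` J)"
          if "finite J" "\<forall>i\<in>J. 0 \<le> t i" "sum t J > 0" for J
          by (rule convex_sum) (use that in \<open>auto simp: sum_divide_distrib[symmetric] hull_inc\<close>)
        have "(\<Sum>i\<in>J. (t i / c) *\<^sub>R \<phi> i) = (1 / c) *\<^sub>R (\<Sum>i\<in>J. t i *\<^sub>R \<phi> i)" for J c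
          by (simp add: scaleR_sum_right)
        then have "(\<Sum>i\<in>I1. (t i / sum t I1) *\<^sub>R \<phi> i) = (\<Sum>i\<in>I2. (t i / sum t I2) *\<^sub>R \<phi> i)"
          using eqs by simp
        then show False using mem[of I1] mem[of I2] nn T eqs(2) split disj by auto
      qed
      then have "\<forall>i\<in>I1. t i = 0" "\<forall>i\<in>I2. t i = 0"
        using eqs(2) nn split by (simp_all add: sum_nonneg_eq_0_iff)
      then show "\<forall>i\<in>I. t i = 0" using split(1) by blast
    qed
  qed
  then obtain u b where z: "(u, b) \<noteq> (0 :: 'a \<times> real)" "\<mu> (one_sided P F (u, b)) \<le> k + 1"
    by (metis surj_pair)
  show ?thesis
  proof (cases "u = 0")
    \<comment> \<open>With \<open>u = 0\<close> there is no hyperplane, but every member counts as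
      one-sided, so \<open>F\<close> itself has rank at most \<open>k + 1\<close> and the empty
      subfamily serves.\<close>
    case True
    then have "b \<noteq> 0" using z(1) by (simp add: zero_prod_def)
    then have "one_sided P F (u, b) = F" using True by (auto simp: one_sided_def P_def)
    moreover have "has_hyperplane_transversal K {}"
      using nonzero_Basis nonempty_Basis unfolding has_hyperplane_transversal_def hyperplane_def by blast
    ultimately show ?thesis using z(2) by (intro exI[of _ "{}"]) simp
  next
    case False
    define G where "G = F - one_sided P F (u, b)"
    have "{x. u \<bullet> x = b} \<inter> K i \<noteq> {}" if "i \<in> G" for i
    proof -
      have iF: "i \<in> F" and "\<not> (\<forall>p\<in>X \<inter> K i. b < u \<bullet> p)" "\<not> (\<forall>p\<in>X \<inter> K i. u \<bullet> p < b)"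
        using that by (auto simp: G_def one_sided_def P_def)
      then obtain p q where "p \<in> K i" "q \<in> K i" "u \<bullet> p \<le> b" "b \<le> u \<bullet> q" by force
      then show ?thesis
        using connected_ivt_hyperplane[OF convex_connected[OF conv[OF iF]], of p q u b] by blast
    qed
    then have "has_hyperplane_transversal K G"
      using False unfolding has_hyperplane_transversal_def hyperplane_def by blast
    moreover have "F - G = one_sided P F (u, b)" by (auto simp: G_def one_sided_def)
    ultimately show ?thesis using z(2) by (intro exI[of _ G]) (auto simp: G_def)
  qed
qed

text \<open>Empty members cannot simply be dropped: they lie outside every \<open>G\<close> with a
  transversal, so their rank counts in \<open>F - G\<close>.\<close>

theorem mainTheorem1:
  fixes F :: "'i set"
    and K :: "'i \<Rightarrow> 'a::euclidean_space set"
    and \<mu> :: "'i set \<Rightarrow> nat"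
    and k :: nat
    and V :: "'b::euclidean_space set"
    and \<phi> :: "'i \<Rightarrow> 'b"
  assumes "finite F"
    and "\<And>i. i \<in> F \<Longrightarrow> convex (K i)"
    and "matroid_rank F \<mu>"
    and "loopless F \<mu>"
    and "k < DIM('a)"
    and "real_space_of_dim k V"
    and "\<phi> \<in> F \<rightarrow> V"
    and "\<And>G1 G2. \<lbrakk> G1 \<subseteq> F; G2 \<subseteq> F; \<mu> (G1 \<union> G2) = card G1 + card G2;
           conv_family K G1 \<inter> conv_family K G2 = {} \<rbrakk>
         \<Longrightarrow> convex hull (\<phi> ` G1) \<inter> convex hull (\<phi> ` G2) = {}"
  shows "\<exists>G. G \<subseteq> F \<and> \<mu> (F - G) \<le> k + 1 \<and> has_hyperplane_transversal K G"
proof -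
  note M = matroid_rankD[OF assms(3)]
  \<comment> \<open>An empty member is replaced by \<open>DIM('a) + 1\<close> parallel affinely independent points; every
    hyperplane misses one of them.\<close>
  define F' where "F' = (SIGMA i:F. if K i = {} then insert 0 Basis else {0 :: 'a})"
  define K' where "K' x = (if K (fst x) = {} then {snd x} else K (fst x))" for x :: "'i \<times> 'a"
  define \<mu>' where "\<mu>' Y = \<mu> (fst ` Y)" for Y :: "('i \<times> 'a) set"
  have finF': "finite F'" unfolding F'_def using assms(1) by (intro finite_SigmaI) auto
  have fstF: "fst ` Y \<subseteq> F" if "Y \<subseteq> F'" for Y using that by (auto simp: F'_def)
  have M': "matroid_rank F' \<mu>'"
    unfolding matroid_rank_def
  proof (intro conjI allI impI finF')
    fix Y assume "Y \<subseteq> F'"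
    then have "\<mu>' Y \<le> card (fst ` Y)" "finite Y"
      using M(2)[OF fstF] finF' finite_subset by (auto simp: \<mu>'_def)
    then show "\<mu>' Y \<le> card Y" using card_image_le[of Y fst] by linarith
  next
    fix Y Z assume "Y \<subseteq> Z \<and> Z \<subseteq> F'"
    then show "\<mu>' Y \<le> \<mu>' Z" unfolding \<mu>'_def by (intro M(3) image_mono fstF) auto
  next
    fix Y Z assume YZ: "Y \<subseteq> F' \<and> Z \<subseteq> F'"
    have "\<mu> (fst ` (Y \<inter> Z)) \<le> \<mu> (fst ` Y \<inter> fst ` Z)" by (rule M(3)) (use YZ fstF in auto)
    moreover have "\<mu> (fst ` Y \<union> fst ` Z) + \<mu> (fst ` Y \<inter> fst ` Z) \<le> \<mu> (fst ` Y) + \<mu> (fst ` Z)"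
      by (rule M(4)) (use YZ fstF in auto)
    ultimately show "\<mu>' (Y \<union> Z) + \<mu>' (Y \<inter> Z) \<le> \<mu>' Y + \<mu>' Z" by (simp add: \<mu>'_def image_Un)
  qed
  have "\<exists>G. G \<subseteq> F' \<and> \<mu>' (F' - G) \<le> k + 1 \<and> has_hyperplane_transversal K' G"
  proof (rule transversal_nonempty_members[OF M', where V = V and \<phi> = "\<phi> \<circ> fst"])
    show "convex (K' x)" if "x \<in> F'" for x using that assms(2) by (auto simp: K'_def F'_def)
    show "K' x \<noteq> {}" for x by (simp add: K'_def)
    show "subspace V" "dim V = k" using assms(6) by (auto simp: real_space_of_dim_def)
    show "(\<phi> \<circ> fst) x \<in> V" if "x \<in> F'" for x using that assms(7) by (auto simp: F'_def)
    fix G1 G2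
    assume G: "G1 \<subseteq> F'" "G2 \<subseteq> F'" "\<mu>' (G1 \<union> G2) = card G1 + card G2"
      "conv_family K' G1 \<inter> conv_family K' G2 = {}"
    have "finite G1" "finite G2" using G finF' finite_subset by blast+
    then have cards: "card (fst ` G1) \<le> card G1" "card (fst ` G2) \<le> card G2" by (simp_all add: card_image_le)
    have "\<mu> (fst ` G1 \<union> fst ` G2) \<le> card (fst ` G1 \<union> fst ` G2)" by (rule M(2)) (use G fstF in auto)
    also have "\<dots> \<le> card (fst ` G1) + card (fst ` G2)" by (rule card_Un_le)
    \<comment> \<open>The bounds leave only equality, so the rank condition passes from
      \<open>G1\<close> and \<open>G2\<close> to their projections.\<close>
    finally have "\<mu> (fst ` G1 \<union> fst ` G2) = card (fst ` G1) + card (fst ` G2)"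
      using G(3) cards by (simp add: \<mu>'_def image_Un)
    moreover have "conv_family K (fst ` H) \<subseteq> conv_family K' H" for H
      unfolding conv_family_def by (rule hull_mono) (auto simp: K'_def)
    then have "conv_family K (fst ` G1) \<inter> conv_family K (fst ` G2) = {}" using G(4) by blast
    ultimately have "convex hull (\<phi> ` fst ` G1) \<inter> convex hull (\<phi> ` fst ` G2) = {}"
      using G fstF by (intro assms(8)) auto
    then show "convex hull ((\<phi> \<circ> fst) ` G1) \<inter> convex hull ((\<phi> \<circ> fst) ` G2) = {}"
      by (simp add: image_comp)
  qed (rule assms(5))
  then obtain G' H where G': "G' \<subseteq> F'" "\<mu>' (F' - G') \<le> k + 1" "hyperplane H" "\<And>x. x \<in> G' \<Longrightarrow> H \<inter> K' x \<noteq> {}"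
    unfolding has_hyperplane_transversal_def by blast
  define G where "G = {i\<in>F. K i \<noteq> {} \<and> (i, 0) \<in> G'}"
  have "\<exists>p\<in>insert 0 Basis. p \<notin> H"
  proof -
    obtain a b where H: "a \<noteq> 0" "H = {x. a \<bullet> x = b}" using G'(3) by (auto simp: hyperplane_def)
    show ?thesis
    proof (rule ccontr)
      assume "\<not> ?thesis"
      then have "b = 0" "\<forall>e\<in>Basis. a \<bullet> e = b" using H(2) by auto
      then show False using H(1) euclidean_all_zero_iff by blast
    qed
  qed
  then obtain p where p: "p \<in> insert 0 Basis" "p \<notin> H" by blast
  \<comment> \<open>Each index outside \<open>G\<close> has a copy outside \<open>G'\<close>: for an
    empty member the copy at the point \<open>p\<close> off \<open>H\<close>, otherwise its only
    copy.\<close>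
  have "F - G \<subseteq> fst ` (F' - G')"
  proof
    fix i assume i: "i \<in> F - G"
    show "i \<in> fst ` (F' - G')"
    proof (cases "K i = {}")
      case True
      then have "(i, p) \<in> F'" using i p(1) by (auto simp: F'_def)
      moreover have "(i, p) \<notin> G'" using G'(4)[of "(i, p)"] p(2) True by (auto simp: K'_def)
      ultimately show ?thesis by force
    next
      case False
      then have "(i, 0) \<in> F' - G'" using i by (auto simp: F'_def G_def)
      then show ?thesis by force
    qed
  qed
  then have "\<mu> (F - G) \<le> \<mu> (fst ` (F' - G'))" by (rule M(3)) (rule fstF, blast)
  then have "\<mu> (F - G) \<le> k + 1" using G'(2) by (simp add: \<mu>'_def)
  moreover have "has_hyperplane_transversal K G"
    unfolding has_hyperplane_transversal_def
  proof (intro exI[of _ H] conjI ballI G'(3))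
    fix i assume "i \<in> G"
    then show "H \<inter> K i \<noteq> {}" using G'(4)[of "(i, 0)"] by (auto simp: G_def K'_def)
  qed
  ultimately show ?thesis by (intro exI[of _ G]) (auto simp: G_def)
qed

end
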